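(* Let $I=\{1,\dots,n\}$ be a finite set of agents, $\Phi$ a set of primitive propositions, and $\Theta$ a countable dense subset of $[0,1]$. Let $\mathcal{M}=((\Omega,(\mathit{Pr}_i)_{i\in I}),\pi)$ be a probability model over $(\Phi,I)$, and let $\mathcal{T}_{\mathcal M}=(X,(T_i)_{i\in I},(\beta_i)_{i\in I})$ be the structure built from $\mathcal M$ using the language $\mathcal{L}_B^\Theta(\Phi,I)$ as described in the context. Then $\mathcal{T}_{\mathcal M}$ is a type space. Define $\nu(p)=E_0(p)$ for $p\in\Phi$. Then $\mathcal{I}_{\mathcal M}=(\mathcal{T}_{\mathcal M},\nu)$ is an interpreted type space, and for all $\phi\in\mathcal{L}_B^\Theta(\Phi,I)$ and all $\omega\in\Omega$, $$\omega\in[\![\phi]\!]_{\mathcal M}\ \Rightarrow\ (d_0(\omega),d(\omega))\in[\![\phi]\!]_{\mathcal{I}_{\mathcal M}},$$ where $d(\omega)=(d_1(\omega),\dots,d_n(\omega))$.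
   Context: **Measure theory.** A measurable space is a set $Y$ with a $\sigma$-algebra $\Sigma_Y$. $\Delta(Y)$ is the set of probability measures on $Y$ with the $\sigma$-algebra generated by the sets $\mathcal{B}^\theta(E)=\{\mu\in\Delta(Y):\mu(E)\ge\theta\}$, $\theta\in[0,1]$, $E\in\Sigma_Y$. Finite products carry the product $\sigma$-algebra. For $\mu\in\Delta(Y)$ and $A\subseteq Y$, $\mu^*(A)=\inf\{\mu(E):E\in\Sigma_Y,\ E\supseteq A\}$. Write $T=\prod_{i\in I}T_i$. **Type spaces.** A type space (over $I$) is $\mathcal{T}=(X,(T_i)_{i\in I},(\beta_i)_{i\in I})$ where $X$ and each $T_i$ are measurable spaces and each $\beta_i:T_i\to\Delta(X\times T)$ is a measurable function such that the marginal of $\beta_i(t_i)$ on $T_i$ is $\delta_{t_i}$ (for events $E\subseteq T_i$, $\delta_{t_i}(E)=1$ if $t_i\in E$ and $0$ otherwise). **Language.** $\mathcal{L}_B^\Theta(\Phi,I)$ is generated by $\phi::=p\mid\lnot\phi\mid\phi\land\psi\mid B_i^\theta\phi$ with $p\in\Phi$, $i\in I$, $\theta\in\Theta$. **Interpreted type spaces.** An interpreted type space over $(\Phi,I)$ is $\mathcal I=(\mathcal T,\nu)$ with $\mathcal T$ a type space and $\nu:\Phi\to\Sigma_X$ any map. Truth sets: $[\![p]\!]_{\mathcal I}=\nu(p)\times T$, $[\![\lnot\phi]\!]_{\mathcal I}=(X\times T)\setminus[\![\phi]\!]_{\mathcal I}$, $[\![\phi\land\psi]\!]_{\mathcal I}=[\![\phi]\!]_{\mathcal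 I}\cap[\![\psi]\!]_{\mathcal I}$, $[\![B_i^\theta\phi]\!]_{\mathcal I}=\{(x,t)\in X\times T:\beta_i(t_i)([\![\phi]\!]_{\mathcal I})\ge\theta\}$. **Probability models.** A probability frame (over $I$) is $(\Omega,(\mathit{Pr}_i)_{i\in I})$ where $\Omega$ is a measurable space and each $\mathit{Pr}_i:\Omega\to\Delta(\Omega)$ is measurable with $\mathit{Pr}_i(\omega)^*(\mathit{Pr}_i^{-1}(\mathit{Pr}_i(\omega)))=1$ for all $\omega$. A probability model over $(\Phi,I)$ is a probability frame together with a map $\pi:\Phi\to\Sigma_\Omega$. Truth sets: $[\![p]\!]_{\mathcal M}=\pi(p)$, $[\![\lnot\phi]\!]_{\mathcal M}=\Omega\setminus[\![\phi]\!]_{\mathcal M}$, $[\![\phi\land\psi]\!]_{\mathcal M}=[\![\phi]\!]_{\mathcal M}\cap[\![\psi]\!]_{\mathcal M}$, $[\![B_i^\theta\phi]\!]_{\mathcal M}=\{\omega:\mathit{Pr}_i(\omega)([\![\phi]\!]_{\mathcal M})\ge\theta\}$. A set of formulas is satisfiable if all its members are true at one common world of some probability model. **Construction of $\mathcal{T}_{\mathcal M}$.** Let $\mathcal L=\mathcal{L}_B^\Theta(\Phi,I)$. A description is a satisfiable set $D\subseteq\mathcal L$ such that for each $\phi\in\mathcal L$, $\phi\in D$ or $\lnot\phi\in D$. For $\omega\in\Omega$ let $D(\omega)=\{\phi\in\mathcal L:\omega\in[\![\phi]\!]_{\mathcal M}\}$; let $d_0(\omega)\subseteq D(\omega)$ consist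 of its purely propositional formulas (Boolean combinations of primitive propositions), and $d_i(\omega)\subseteq D(\omega)$ of its formulas that are Boolean combinations of formulas of the form $B_i^\theta\phi$. Set $X=\{d_0(\omega):\omega\in\Omega\}$ with the $\sigma$-algebra generated by the sets $E_0(\phi)=\{x\in X:\phi\in x\}$, $\phi\in\mathcal L$, and $T_i=\{d_i(\omega):\omega\in\Omega\}$ with the $\sigma$-algebra generated by $E_i(\phi)=\{t_i\in T_i:\phi\in t_i\}$, $\phi\in\mathcal L$. For $(x,t)\in X\times T$ there is a unique description $D(x,t)\supseteq x\cup\bigcup_i t_i$; put $[\phi]=\{(x,t)\in X\times T:\phi\in D(x,t)\}$. Since $\Theta$ is dense in $[0,1]$, for each $t_i\in T_i$ there is exactly one probability measure $\mu$ on $X\times T$ such that for all $\phi\in\mathcal L$ and $\theta\in\Theta$: $\mu([\phi])\ge\theta\iff B_i^\theta\phi\in t_i$; $\beta_i(t_i)$ is defined to be this measure. *)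

theory Defs
  imports "HOL-Probability.Probability"
begin

text \<open>
  Measurable spaces are elements of type \<open>'a measure\<close> of which only \<^const>\<open>space\<close> and
  \<^const>\<open>sets\<close> matter.  The space of probability measures on \<open>M\<close> is
  \<^term>\<open>prob_algebra M\<close>; the following lemma shows that its \<open>\<sigma>\<close>-algebra is generated by the
  sets of measures giving an event \<open>E\<close> probability at least \<open>\<theta>\<close>.
\<close>

lemma sets_prob_algebra_eq_threshold:
  "sets (prob_algebra M) =
     sigma_sets (space (prob_algebra M))
       {{\<mu> \<in> space (prob_algebra M). measure \<mu> E \<ge> \<theta>} | E \<theta>. E \<in> sets M \<and> 0 \<le> \<theta> \<and> \<theta> \<le> 1}"
  (is "_ = sigma_sets ?S ?G")
proof
  have G: "?G \<subseteq> sets (prob_algebra M)"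
    by auto
  then show "sigma_sets ?S ?G \<subseteq> sets (prob_algebra M)"
    by (rule sets.sigma_sets_subset)
  have Pow: "?G \<subseteq> Pow ?S" by auto
  have meas: "(\<lambda>\<mu>. measure \<mu> E) \<in> borel_measurable (sigma ?S ?G)" if E: "E \<in> sets M" for E
    unfolding borel_measurable_iff_ge
  proof
    fix a :: real
    consider "a < 0" | "0 \<le> a \<and> a \<le> 1" | "1 < a" by linarith
    then show "{w \<in> space (sigma ?S ?G). a \<le> measure w E} \<in> sets (sigma ?S ?G)"
    proof cases
      case 1
      then have "{w \<in> space (sigma ?S ?G). a \<le> measure w E} = space (sigma ?S ?G)"
        by (auto intro: order_trans[OF less_imp_le measure_nonneg])
      then show ?thesis by (metis sets.top)
    next
      case 2
      then have "{w \<in> ?S. a \<le> measure w E} \<in> ?G"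
        using E by blast
      then show ?thesis
        using Pow by (simp add: space_measure_of sets_measure_of sigma_sets.Basic)
    next
      case 3
      have "measure w E \<le> 1" if "w \<in> ?S" for w
        using that by (auto simp: space_prob_algebra intro: prob_space.prob_le_1)
      then have "{w \<in> space (sigma ?S ?G). a \<le> measure w E} = {}"
        using 3 Pow by (fastforce simp: space_measure_of)
      then show ?thesis by (metis sets.empty_sets)
    qed
  qed
  have "(\<lambda>\<mu>. \<mu>) \<in> measurable (sigma ?S ?G) (prob_algebra M)"
  proof (rule measurable_prob_algebra_generated[where \<Omega> = "space M" and G = "sets M"])
    show "sets M = sigma_sets (space M) (sets M)"
      by (simp add: sets.sigma_sets_eq)
    show "Int_stable (sets M)"
      by (rule sets.Int_stable)
    show "sets M \<subseteq> Pow (space M)"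
      by (rule sets.space_closed)
    fix \<mu> assume "\<mu> \<in> space (sigma ?S ?G)"
    then have mu: "\<mu> \<in> ?S" using Pow by (simp add: space_measure_of)
    then show "prob_space \<mu>" "sets \<mu> = sets M" by (auto simp: space_prob_algebra)
  next
    fix A assume A: "A \<in> sets M"
    have *: "(\<lambda>\<mu>. ennreal (measure \<mu> A)) \<in> borel_measurable (sigma ?S ?G)"
      using meas[OF A] by measurable
    have "emeasure \<mu> A = ennreal (measure \<mu> A)" if "\<mu> \<in> space (sigma ?S ?G)" for \<mu>
    proof -
      have "prob_space \<mu>" using that Pow by (simp add: space_measure_of space_prob_algebra)
      then interpret prob_space \<mu> .
      show ?thesis by (rule emeasure_eq_measure)
    qed
    then show "(\<lambda>\<mu>. emeasure \<mu> A) \<in> borel_measurable (sigma ?S ?G)"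
      using * by (simp cong: measurable_cong)
  qed
  then have ident: "(\<lambda>\<mu>. \<mu>) \<in> measurable (sigma ?S ?G) (prob_algebra M)" .
  have sp: "space (sigma ?S ?G) = ?S" and st: "sets (sigma ?S ?G) = sigma_sets ?S ?G"
    using Pow by (simp_all add: space_measure_of sets_measure_of)
  show "sets (prob_algebra M) \<subseteq> sigma_sets ?S ?G"
  proof
    fix A assume A: "A \<in> sets (prob_algebra M)"
    have "(\<lambda>\<mu>. \<mu>) -` A \<inter> space (sigma ?S ?G) \<in> sets (sigma ?S ?G)"
      by (rule measurable_sets[OF ident A])
    moreover have "(\<lambda>\<mu>. \<mu>) -` A \<inter> space (sigma ?S ?G) = A"
      using sets.sets_into_space[OF A] by (simp only: sp) blast
    ultimately show "A \<in> sigma_sets ?S ?G"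
      by (simp only: st)
  qed
qed


section \<open>Language\<close>

datatype ('p, 'i) fm =
    Prop 'p
  | Neg "('p, 'i) fm"
  | Conj "('p, 'i) fm" "('p, 'i) fm"
  | Bel 'i real "('p, 'i) fm"

inductive_set lang :: "'p set \<Rightarrow> 'i set \<Rightarrow> real set \<Rightarrow> ('p, 'i) fm set"
  for \<Phi> :: "'p set" and I :: "'i set" and \<Theta> :: "real set"
where
  "p \<in> \<Phi> \<Longrightarrow> Prop p \<in> lang \<Phi> I \<Theta>"
| "\<phi> \<in> lang \<Phi> I \<Theta> \<Longrightarrow> Neg \<phi> \<in> lang \<Phi> I \<Theta>"
| "\<phi> \<in> lang \<Phi> I \<Theta> \<Longrightarrow> \<psi> \<in> lang \<Phi> I \<Theta> \<Longrightarrow> Conj \<phi> \<psi> \<in> lang \<Phi> I \<Theta>"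
| "\<phi> \<in> lang \<Phi> I \<Theta> \<Longrightarrow> i \<in> I \<Longrightarrow> \<theta> \<in> \<Theta> \<Longrightarrow> Bel i \<theta> \<phi> \<in> lang \<Phi> I \<Theta>"

inductive_set bool_comb :: "('p, 'i) fm set \<Rightarrow> ('p, 'i) fm set"
  for A :: "('p, 'i) fm set"
where
  "\<phi> \<in> A \<Longrightarrow> \<phi> \<in> bool_comb A"
| "\<phi> \<in> bool_comb A \<Longrightarrow> Neg \<phi> \<in> bool_comb A"
| "\<phi> \<in> bool_comb A \<Longrightarrow> \<psi> \<in> bool_comb A \<Longrightarrow> Conj \<phi> \<psi> \<in> bool_comb A"


section \<open>Type spaces\<close>

text \<open>
  The type sets \<open>T\<^sub>i\<close> share one HOL type \<open>'t\<close>, but their carriers and \<open>\<sigma>\<close>-algebras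
  may depend on \<open>i\<close>.  Type profiles are the extensional functions in the product over \<open>I\<close>.
\<close>

record ('x, 't, 'i) type_structure =
  states :: "'x measure"
  types :: "'i \<Rightarrow> 't measure"
  beta :: "'i \<Rightarrow> 't \<Rightarrow> ('x \<times> ('i \<Rightarrow> 't)) measure"

definition product_space ::
  "'i set \<Rightarrow> ('x, 't, 'i) type_structure \<Rightarrow> ('x \<times> ('i \<Rightarrow> 't)) measure" where
  "product_space I S = states S \<Otimes>\<^sub>M (\<Pi>\<^sub>M i\<in>I. types S i)"

definition type_space :: "'i set \<Rightarrow> ('x, 't, 'i) type_structure \<Rightarrow> bool" where
  "type_space I S \<longleftrightarrow>
     (\<forall>i\<in>I. beta S i \<in> measurable (types S i) (prob_algebra (product_space I S)) \<and>
        (\<forall>s\<in>space (types S i).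
           distr (beta S i s) (types S i) (\<lambda>(x, t). t i) = return (types S i) s))"

definition interpreted_type_space ::
  "'p set \<Rightarrow> 'i set \<Rightarrow> ('x, 't, 'i) type_structure \<Rightarrow> ('p \<Rightarrow> 'x set) \<Rightarrow> bool" where
  "interpreted_type_space \<Phi> I S \<nu> \<longleftrightarrow> type_space I S \<and> (\<forall>p\<in>\<Phi>. \<nu> p \<in> sets (states S))"

primrec type_truth ::
  "'i set \<Rightarrow> ('x, 't, 'i) type_structure \<Rightarrow> ('p \<Rightarrow> 'x set) \<Rightarrow> ('p, 'i) fm
     \<Rightarrow> ('x \<times> ('i \<Rightarrow> 't)) set"
where
  "type_truth I S \<nu> (Prop p) = \<nu> p \<times> space (\<Pi>\<^sub>M i\<in>I. types S i)"
| "type_truth I S \<nu> (Neg \<phi>) = space (product_space I S) - type_truth I S \<nu> \<phi>"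
| "type_truth I S \<nu> (Conj \<phi> \<psi>) = type_truth I S \<nu> \<phi> \<inter> type_truth I S \<nu> \<psi>"
| "type_truth I S \<nu> (Bel i \<theta> \<phi>) =
     {(x, t) \<in> space (product_space I S). measure (beta S i (t i)) (type_truth I S \<nu> \<phi>) \<ge> \<theta>}"


section \<open>Probability models\<close>

record ('w, 'i) prob_structure =
  worlds :: "'w measure"
  Pr :: "'i \<Rightarrow> 'w \<Rightarrow> 'w measure"

text \<open>
  Elements of \<^term>\<open>prob_algebra M\<close> all have the \<open>\<sigma>\<close>-algebra of \<open>M\<close>, so HOL equality between
  them is equality of probability measures.
\<close>

definition probability_frame :: "'i set \<Rightarrow> ('w, 'i) prob_structure \<Rightarrow> bool" where
  "probability_frame I F \<longleftrightarrow>
     (\<forall>i\<in>I. Pr F i \<in> measurable (worlds F) (prob_algebra (worlds F)) \<and>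
        (\<forall>\<omega>\<in>space (worlds F).
           outer_measure_of (Pr F i \<omega>) {\<omega>' \<in> space (worlds F). Pr F i \<omega>' = Pr F i \<omega>} = 1))"

definition probability_model ::
  "'p set \<Rightarrow> 'i set \<Rightarrow> ('w, 'i) prob_structure \<Rightarrow> ('p \<Rightarrow> 'w set) \<Rightarrow> bool" where
  "probability_model \<Phi> I F \<pi> \<longleftrightarrow>
     probability_frame I F \<and> (\<forall>p\<in>\<Phi>. \<pi> p \<in> sets (worlds F))"

primrec truth :: "('w, 'i) prob_structure \<Rightarrow> ('p \<Rightarrow> 'w set) \<Rightarrow> ('p, 'i) fm \<Rightarrow> 'w set"
where
  "truth F \<pi> (Prop p) = \<pi> p"
| "truth F \<pi> (Neg \<phi>) = space (worlds F) - truth F \<pi> \<phi>"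
| "truth F \<pi> (Conj \<phi> \<psi>) = truth F \<pi> \<phi> \<inter> truth F \<pi> \<psi>"
| "truth F \<pi> (Bel i \<theta> \<phi>) =
     {\<omega> \<in> space (worlds F). measure (Pr F i \<omega>) (truth F \<pi> \<phi>) \<ge> \<theta>}"

definition satisfiable_on :: "'w itself \<Rightarrow> 'p set \<Rightarrow> 'i set \<Rightarrow> ('p, 'i) fm set \<Rightarrow> bool" where
  "satisfiable_on W \<Phi> I D \<longleftrightarrow>
     (\<exists>(F :: ('w, 'i) prob_structure) \<pi>. probability_model \<Phi> I F \<pi> \<and>
        (\<exists>\<omega>\<in>space (worlds F). \<forall>\<phi>\<in>D. \<omega> \<in> truth F \<pi> \<phi>))"

text \<open>
  A definition cannot quantify over all types of worlds.  Nothing is lost by taking sets of formulas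
  as worlds: every model can be replaced by its quotient modulo logical equivalence of worlds, see
  lemma \<open>satisfiable_on_imp_satisfiable\<close>.
\<close>

definition satisfiable :: "'p set \<Rightarrow> 'i set \<Rightarrow> ('p, 'i) fm set \<Rightarrow> bool" where
  "satisfiable \<Phi> I D \<longleftrightarrow> satisfiable_on TYPE(('p, 'i) fm set) \<Phi> I D"

lemma truth_in_sets:
  assumes "probability_model \<Phi> I F \<pi>" and "\<phi> \<in> lang \<Phi> I \<Theta>"
  shows "truth F \<pi> \<phi> \<in> sets (worlds F)"
  using assms(2)
proof induction
  case (4 \<phi> i \<theta>)
  have "(\<lambda>\<omega>. measure (Pr F i \<omega>) (truth F \<pi> \<phi>)) \<in> borel_measurable (worlds F)"
    using assms(1) 4
    by (intro measurable_compose[OF _ measurable_measure_prob_algebra])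
       (auto simp: probability_model_def probability_frame_def)
  then show ?case by simp
qed (use assms(1) in \<open>auto simp: probability_model_def\<close>)

lemma satisfiable_on_imp_satisfiable:
  fixes D :: "('p, 'i) fm set"
  assumes sat: "satisfiable_on TYPE('w) \<Phi> I D" and D: "D \<subseteq> lang \<Phi> I UNIV"
  shows "satisfiable \<Phi> I D"
proof -
  obtain F :: "('w, 'i) prob_structure" and \<pi> \<omega>\<^sub>0
    where model: "probability_model \<Phi> I F \<pi>" and \<omega>\<^sub>0: "\<omega>\<^sub>0 \<in> space (worlds F)"
      and sat0: "\<forall>\<phi>\<in>D. \<omega>\<^sub>0 \<in> truth F \<pi> \<phi>"
    using sat unfolding satisfiable_on_def by blast
  define L where "L = lang \<Phi> I UNIV"
  define \<Omega> where "\<Omega> = worlds F"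
  define q where "q \<omega> = {\<phi> \<in> L. \<omega> \<in> truth F \<pi> \<phi>}" for \<omega>
  define Q where "Q = q ` space \<Omega>"
  define B where "B \<phi> = {d \<in> Q. \<phi> \<in> d}" for \<phi>
  define G where "G = insert Q (B ` L)"
  define N where "N = sigma Q G"
  define rep where "rep d = (SOME \<omega>. \<omega> \<in> space \<Omega> \<and> q \<omega> = d)" for d
  define F' where "F' = \<lparr>worlds = N, Pr = (\<lambda>i d. distr (Pr F i (rep d)) N q)\<rparr>"
  define \<pi>' where "\<pi>' p = B (Prop p)" for p
  have GPow: "G \<subseteq> Pow Q" by (auto simp: G_def B_def)
  have spN: "space N = Q" and setsN: "sets N = sigma_sets Q G"
    using GPow by (auto simp: N_def)
  have BN: "B \<phi> \<in> sets N" if "\<phi> \<in> L" for \<phi>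
    using that by (auto simp: setsN G_def)
  have tr: "truth F \<pi> \<phi> \<in> sets \<Omega>" if "\<phi> \<in> L" for \<phi>
    using truth_in_sets[OF model] that by (simp add: L_def \<Omega>_def)
  have pre: "q -` B \<phi> \<inter> space \<Omega> = truth F \<pi> \<phi>" if "\<phi> \<in> L" for \<phi>
    using that sets.sets_into_space[OF tr[OF that]] by (auto simp: B_def Q_def q_def)
  have L_Conj: "Conj \<phi> \<psi> \<in> L" if "\<phi> \<in> L" "\<psi> \<in> L" for \<phi> \<psi>
    using that unfolding L_def by (rule lang.intros)
  have L_Bel: "Bel i \<theta> \<phi> \<in> L" if "\<phi> \<in> L" "i \<in> I" for i \<theta> \<phi>
    using that UNIV_I unfolding L_def by (rule lang.intros)
  have Q_Conj: "Conj \<phi> \<psi> \<in> d \<longleftrightarrow> \<phi> \<in> d \<and> \<psi> \<in> d" if d: "d \<in> Q" and "\<phi> \<in> L" "\<psi> \<in> L" for d \<phi> \<psi>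
  proof -
    obtain \<omega> where "d = q \<omega>" using d unfolding Q_def by blast
    then show ?thesis using that L_Conj by (simp add: q_def)
  qed
  have Q_Neg: "Neg \<phi> \<in> d \<longleftrightarrow> \<phi> \<notin> d" if d: "d \<in> Q" and "\<phi> \<in> L" for d \<phi>
  proof -
    obtain \<omega> where "d = q \<omega>" "\<omega> \<in> space \<Omega>" using d unfolding Q_def by blast
    moreover have "Neg \<phi> \<in> L" using that(2) unfolding L_def by (rule lang.intros)
    ultimately show ?thesis using that by (simp add: q_def \<Omega>_def)
  qed
  have B_Conj: "B \<phi> \<inter> B \<psi> = B (Conj \<phi> \<psi>)" if "\<phi> \<in> L" "\<psi> \<in> L" for \<phi> \<psi>
    using Q_Conj[OF _ that] by (auto simp: B_def)
  have stable: "Int_stable G"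
  proof (rule Int_stableI)
    fix a b assume a: "a \<in> G" and b: "b \<in> G"
    have sub: "a \<subseteq> Q" "b \<subseteq> Q" using a b GPow by auto
    show "a \<inter> b \<in> G"
    proof (cases "a = Q \<or> b = Q")
      case True
      then have "a \<inter> b = b \<or> a \<inter> b = a" using sub by auto
      then show ?thesis using a b by auto
    next
      case False
      then obtain \<phi> \<psi> where "\<phi> \<in> L" "a = B \<phi>" "\<psi> \<in> L" "b = B \<psi>"
        using a b by (auto simp: G_def)
      then have "a \<inter> b = B (Conj \<phi> \<psi>)" "Conj \<phi> \<psi> \<in> L" using B_Conj L_Conj by auto
      then show ?thesis unfolding G_def by blast
    qed
  qed
  have q_meas: "q \<in> measurable \<Omega> N"
    unfolding N_def
  proof (rule measurable_measure_of)
    fix y assume "y \<in> G"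
    moreover have "q -` Q \<inter> space \<Omega> = space \<Omega>" by (auto simp: Q_def)
    ultimately show "q -` y \<inter> space \<Omega> \<in> sets \<Omega>"
      using pre tr by (auto simp: G_def)
  qed (use GPow in \<open>auto simp: Q_def\<close>)
  have P: "prob_space (Pr F i \<omega>)" "sets (Pr F i \<omega>) = sets \<Omega>" "space (Pr F i \<omega>) = space \<Omega>"
    if "i \<in> I" "\<omega> \<in> space \<Omega>" for i \<omega>
  proof -
    have "Pr F i \<omega> \<in> space (prob_algebra \<Omega>)"
      using model that unfolding probability_model_def probability_frame_def \<Omega>_def
      by (blast intro: measurable_space)
    then show "prob_space (Pr F i \<omega>)" "sets (Pr F i \<omega>) = sets \<Omega>" "space (Pr F i \<omega>) = space \<Omega>"
      by (auto simp: space_prob_algebra dest: sets_eq_imp_space_eq)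
  qed
  have qP: "q \<in> measurable (Pr F i \<omega>) N" if "i \<in> I" "\<omega> \<in> space \<Omega>" for i \<omega>
    using q_meas by (simp add: measurable_cong_sets[OF P(2)[OF that] refl])
  have Pd: "prob_space (distr (Pr F i \<omega>) N q)" if "i \<in> I" "\<omega> \<in> space \<Omega>" for i \<omega>
    using P(1) qP that by (blast intro: prob_space.prob_space_distr)
  have distr_B: "measure (distr (Pr F i \<omega>) N q) (B \<phi>) = measure (Pr F i \<omega>) (truth F \<pi> \<phi>)"
    if "i \<in> I" "\<omega> \<in> space \<Omega>" "\<phi> \<in> L" for i \<omega> \<phi>
    using that by (simp add: measure_distr qP BN P(3) pre)
  have distr_eq: "distr (Pr F i \<omega>) N q = distr (Pr F i \<omega>') N q"
    if i: "i \<in> I" and w: "\<omega> \<in> space \<Omega>" "\<omega>' \<in> space \<Omega>" and eq: "q \<omega> = q \<omega>'" for i \<omega> \<omega>'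
  proof (rule measure_eqI_generator_eq[OF stable GPow, where A = "\<lambda>_. Q"])
    interpret p1: prob_space "distr (Pr F i \<omega>) N q" using Pd i w by blast
    interpret p2: prob_space "distr (Pr F i \<omega>') N q" using Pd i w by blast
    fix A assume "A \<in> G"
    then consider "A = Q" | \<phi> where "\<phi> \<in> L" "A = B \<phi>" by (auto simp: G_def)
    then show "emeasure (distr (Pr F i \<omega>) N q) A = emeasure (distr (Pr F i \<omega>') N q) A"
    proof cases
      case 1
      then show ?thesis using p1.emeasure_space_1 p2.emeasure_space_1 by (simp add: spN)
    next
      case 2
      have "Bel i \<theta> \<phi> \<in> q \<omega> \<longleftrightarrow> Bel i \<theta> \<phi> \<in> q \<omega>'" for \<theta> using eq by simp
      moreover have "Bel i \<theta> \<phi> \<in> L" for \<theta>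
        using 2 i by (simp add: L_Bel)
      ultimately have "\<theta> \<le> measure (Pr F i \<omega>) (truth F \<pi> \<phi>) \<longleftrightarrow>
          \<theta> \<le> measure (Pr F i \<omega>') (truth F \<pi> \<phi>)" for \<theta>
        using w by (auto simp: q_def \<Omega>_def)
      then have "measure (Pr F i \<omega>) (truth F \<pi> \<phi>) = measure (Pr F i \<omega>') (truth F \<pi> \<phi>)"
        by (meson order_antisym order_refl)
      then show ?thesis
        using distr_B 2 i w by (simp add: p1.emeasure_eq_measure p2.emeasure_eq_measure)
    qed
  next
    show "emeasure (distr (Pr F i \<omega>) N q) Q \<noteq> \<infinity>" for k :: nat
      using Pd[OF i w(1)] by (simp add: finite_measure.emeasure_finite prob_space.finite_measure)
  qed (auto simp: setsN G_def)
  have rep: "rep d \<in> space \<Omega>" "q (rep d) = d" if "d \<in> Q" for d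
    using someI_ex[of "\<lambda>\<omega>. \<omega> \<in> space \<Omega> \<and> q \<omega> = d"] that by (auto simp: Q_def rep_def)
  have Pr'_q: "Pr F' i (q \<omega>) = distr (Pr F i \<omega>) N q" if "i \<in> I" "\<omega> \<in> space \<Omega>" for i \<omega>
    using that rep[of "q \<omega>"] by (auto simp: F'_def Q_def intro: distr_eq)
  have Pr'_B: "measure (Pr F' i d) (B \<phi>) \<ge> \<theta> \<longleftrightarrow> Bel i \<theta> \<phi> \<in> d"
    if "i \<in> I" "d \<in> Q" "\<phi> \<in> L" for i d \<phi> \<theta>
  proof -
    have "Bel i \<theta> \<phi> \<in> L" using that by (simp add: L_Bel)
    then have "Bel i \<theta> \<phi> \<in> q (rep d) \<longleftrightarrow> \<theta> \<le> measure (Pr F i (rep d)) (truth F \<pi> \<phi>)"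
      using rep(1)[OF that(2)] unfolding q_def by (simp add: \<Omega>_def)
    then show ?thesis using rep[OF that(2)] distr_B that by (simp add: F'_def)
  qed
  have Pr'_prob: "prob_space (Pr F' i d)" if "i \<in> I" "d \<in> Q" for i d
    using that rep Pd by (simp add: F'_def)
  have Pr'_meas: "Pr F' i \<in> measurable N (prob_algebra N)" if i: "i \<in> I" for i
  proof (rule measurable_prob_algebra_generated[OF setsN stable GPow])
    fix d assume "d \<in> space N"
    then show "prob_space (Pr F' i d)" using Pr'_prob i spN by simp
    show "sets (Pr F' i d) = sets N" by (simp add: F'_def)
  next
    fix A assume "A \<in> G"
    then consider "A = Q" | \<phi> where "\<phi> \<in> L" "A = B \<phi>" by (auto simp: G_def)
    then show "(\<lambda>d. emeasure (Pr F' i d) A) \<in> borel_measurable N"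
    proof cases
      case 1
      have "emeasure (Pr F' i d) A = 1" if "d \<in> space N" for d
        using prob_space.emeasure_space_1[OF Pr'_prob[OF i, of d]] that 1
        by (simp add: spN F'_def)
      then show ?thesis by (simp cong: measurable_cong)
    next
      case 2
      have "{d \<in> space N. \<theta> \<le> measure (Pr F' i d) A} = B (Bel i \<theta> \<phi>)" for \<theta>
        using Pr'_B i 2 by (auto simp: spN B_def)
      moreover have "Bel i \<theta> \<phi> \<in> L" for \<theta>
        using 2 i by (simp add: L_Bel)
      ultimately have "(\<lambda>d. measure (Pr F' i d) A) \<in> borel_measurable N"
        unfolding borel_measurable_iff_ge using BN by simp
      then have "(\<lambda>d. ennreal (measure (Pr F' i d) A)) \<in> borel_measurable N"
        by measurable
      moreover have "emeasure (Pr F' i d) A = ennreal (measure (Pr F' i d) A)"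
        if "d \<in> space N" for d
        using Pr'_prob i that
        by (simp add: spN finite_measure.emeasure_eq_measure prob_space.finite_measure)
      ultimately show ?thesis by (simp cong: measurable_cong)
    qed
  qed
  have outer: "outer_measure_of (Pr F' i d) {d' \<in> space N. Pr F' i d' = Pr F' i d} = 1"
    if i: "i \<in> I" and d: "d \<in> space N" for i d
  proof (rule antisym)
    interpret p: prob_space "Pr F' i d" using Pr'_prob i d spN by simp
    have sp: "space (Pr F' i d) = space N" by (simp add: F'_def)
    have "outer_measure_of (Pr F' i d) {d' \<in> space N. Pr F' i d' = Pr F' i d}
        \<le> outer_measure_of (Pr F' i d) (space N)"
      by (rule outer_measure_of_mono) auto
    also have "\<dots> = 1"
      using p.emeasure_space_1 sp by (metis outer_measure_of_eq sets.top)
    finally show "outer_measure_of (Pr F' i d) {d' \<in> space N. Pr F' i d' = Pr F' i d} \<le> 1" .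
    define \<omega> where "\<omega> = rep d"
    have \<omega>: "\<omega> \<in> space \<Omega>" "q \<omega> = d" using rep d by (auto simp: \<omega>_def spN)
    show "1 \<le> outer_measure_of (Pr F' i d) {d' \<in> space N. Pr F' i d' = Pr F' i d}"
      unfolding outer_measure_of_def
    proof (rule INF_greatest)
      fix E assume "E \<in> {E \<in> sets (Pr F' i d). {d' \<in> space N. Pr F' i d' = Pr F' i d} \<subseteq> E}"
      then have E: "E \<in> sets N" and sub: "{d' \<in> space N. Pr F' i d' = Pr F' i d} \<subseteq> E"
        by (auto simp: F'_def)
      have "1 = outer_measure_of (Pr F i \<omega>) {\<omega>' \<in> space \<Omega>. Pr F i \<omega>' = Pr F i \<omega>}"
        using model i \<omega> by (simp add: probability_model_def probability_frame_def \<Omega>_def)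
      also have "\<dots> \<le> outer_measure_of (Pr F i \<omega>) (q -` E \<inter> space \<Omega>)"
      proof (rule outer_measure_of_mono, rule subsetI)
        fix \<omega>' assume "\<omega>' \<in> {\<omega>' \<in> space \<Omega>. Pr F i \<omega>' = Pr F i \<omega>}"
        then have w': "\<omega>' \<in> space \<Omega>" "Pr F i \<omega>' = Pr F i \<omega>" by auto
        then have "Pr F' i (q \<omega>') = Pr F' i d" "q \<omega>' \<in> space N"
          using Pr'_q i \<omega> by (auto simp: spN Q_def)
        then show "\<omega>' \<in> q -` E \<inter> space \<Omega>" using sub w' by auto
      qed
      also have "\<dots> = emeasure (Pr F i \<omega>) (q -` E \<inter> space \<Omega>)"
        using E i \<omega> by (intro outer_measure_of_eq) (simp add: P(2) measurable_sets[OF q_meas])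
      also have "\<dots> = emeasure (Pr F' i d) E"
        using Pr'_q[OF i \<omega>(1)] \<omega> E i by (simp add: emeasure_distr qP P(3))
      finally show "1 \<le> emeasure (Pr F' i d) E" .
    qed
  qed
  have wF': "worlds F' = N" by (simp add: F'_def)
  have "probability_model \<Phi> I F' \<pi>'"
    unfolding probability_model_def probability_frame_def wF'
    using Pr'_meas outer BN lang.intros(1)[of _ \<Phi> I UNIV] by (simp add: \<pi>'_def L_def)
  moreover have truth': "truth F' \<pi>' \<phi> = B \<phi>" if "\<phi> \<in> lang \<Phi> I UNIV" for \<phi>
    using that
  proof induction
    case (4 \<phi> i \<theta>)
    then show ?case using Pr'_B by (auto simp: wF' spN B_def L_def)
  next
    case (2 \<phi>)
    then show ?case using Q_Neg by (auto simp: wF' spN B_def L_def)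
  next
    case (3 \<phi> \<psi>)
    then show ?case using B_Conj by (simp add: L_def)
  qed (auto simp: \<pi>'_def)
  moreover have "q \<omega>\<^sub>0 \<in> space (worlds F')"
    using \<omega>\<^sub>0 by (auto simp: wF' spN Q_def \<Omega>_def)
  moreover have "\<forall>\<phi>\<in>D. q \<omega>\<^sub>0 \<in> truth F' \<pi>' \<phi>"
  proof
    fix \<phi> assume "\<phi> \<in> D"
    then have "\<phi> \<in> lang \<Phi> I UNIV" "\<phi> \<in> q \<omega>\<^sub>0"
      using sat0 D by (auto simp: q_def L_def)
    moreover have "q \<omega>\<^sub>0 \<in> Q" using \<omega>\<^sub>0 by (auto simp: Q_def \<Omega>_def)
    ultimately show "q \<omega>\<^sub>0 \<in> truth F' \<pi>' \<phi>" by (simp add: truth' B_def)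
  qed
  ultimately show ?thesis
    unfolding satisfiable_def satisfiable_on_def by blast
qed


section \<open>The type space of a probability model\<close>

definition description :: "'p set \<Rightarrow> 'i set \<Rightarrow> real set \<Rightarrow> ('p, 'i) fm set \<Rightarrow> bool" where
  "description \<Phi> I \<Theta> D \<longleftrightarrow>
     D \<subseteq> lang \<Phi> I \<Theta> \<and> satisfiable \<Phi> I D \<and> (\<forall>\<phi>\<in>lang \<Phi> I \<Theta>. \<phi> \<in> D \<or> Neg \<phi> \<in> D)"

definition world_desc ::
  "'p set \<Rightarrow> 'i set \<Rightarrow> real set \<Rightarrow> ('w, 'i) prob_structure \<Rightarrow> ('p \<Rightarrow> 'w set) \<Rightarrow> 'w
     \<Rightarrow> ('p, 'i) fm set" where
  "world_desc \<Phi> I \<Theta> F \<pi> \<omega> = {\<phi> \<in> lang \<Phi> I \<Theta>. \<omega> \<in> truth F \<pi> \<phi>}"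

definition state_desc ::
  "'p set \<Rightarrow> 'i set \<Rightarrow> real set \<Rightarrow> ('w, 'i) prob_structure \<Rightarrow> ('p \<Rightarrow> 'w set) \<Rightarrow> 'w
     \<Rightarrow> ('p, 'i) fm set" where
  "state_desc \<Phi> I \<Theta> F \<pi> \<omega> = {\<phi> \<in> world_desc \<Phi> I \<Theta> F \<pi> \<omega>. \<phi> \<in> bool_comb (Prop ` \<Phi>)}"

definition agent_desc ::
  "'p set \<Rightarrow> 'i set \<Rightarrow> real set \<Rightarrow> ('w, 'i) prob_structure \<Rightarrow> ('p \<Rightarrow> 'w set) \<Rightarrow> 'i \<Rightarrow> 'w
     \<Rightarrow> ('p, 'i) fm set" where
  "agent_desc \<Phi> I \<Theta> F \<pi> i \<omega> =
     {\<phi> \<in> world_desc \<Phi> I \<Theta> F \<pi> \<omega>.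
        \<phi> \<in> bool_comb {Bel i \<theta> \<psi> | \<theta> \<psi>. \<theta> \<in> \<Theta> \<and> \<psi> \<in> lang \<Phi> I \<Theta>}}"

definition profile_desc ::
  "'p set \<Rightarrow> 'i set \<Rightarrow> real set \<Rightarrow> ('w, 'i) prob_structure \<Rightarrow> ('p \<Rightarrow> 'w set) \<Rightarrow> 'w
     \<Rightarrow> 'i \<Rightarrow> ('p, 'i) fm set" where
  "profile_desc \<Phi> I \<Theta> F \<pi> \<omega> = (\<lambda>i\<in>I. agent_desc \<Phi> I \<Theta> F \<pi> i \<omega>)"

definition formula_space ::
  "'p set \<Rightarrow> 'i set \<Rightarrow> real set \<Rightarrow> ('p, 'i) fm set set \<Rightarrow> ('p, 'i) fm set measure" where
  "formula_space \<Phi> I \<Theta> Y = sigma Y {{y \<in> Y. \<phi> \<in> y} | \<phi>. \<phi> \<in> lang \<Phi> I \<Theta>}"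

definition model_states ::
  "'p set \<Rightarrow> 'i set \<Rightarrow> real set \<Rightarrow> ('w, 'i) prob_structure \<Rightarrow> ('p \<Rightarrow> 'w set)
     \<Rightarrow> ('p, 'i) fm set measure" where
  "model_states \<Phi> I \<Theta> F \<pi> =
     formula_space \<Phi> I \<Theta> (state_desc \<Phi> I \<Theta> F \<pi> ` space (worlds F))"

definition model_types ::
  "'p set \<Rightarrow> 'i set \<Rightarrow> real set \<Rightarrow> ('w, 'i) prob_structure \<Rightarrow> ('p \<Rightarrow> 'w set) \<Rightarrow> 'i
     \<Rightarrow> ('p, 'i) fm set measure" where
  "model_types \<Phi> I \<Theta> F \<pi> i =
     formula_space \<Phi> I \<Theta> (agent_desc \<Phi> I \<Theta> F \<pi> i ` space (worlds F))"

definition model_product ::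
  "'p set \<Rightarrow> 'i set \<Rightarrow> real set \<Rightarrow> ('w, 'i) prob_structure \<Rightarrow> ('p \<Rightarrow> 'w set)
     \<Rightarrow> (('p, 'i) fm set \<times> ('i \<Rightarrow> ('p, 'i) fm set)) measure" where
  "model_product \<Phi> I \<Theta> F \<pi> =
     model_states \<Phi> I \<Theta> F \<pi> \<Otimes>\<^sub>M (\<Pi>\<^sub>M i\<in>I. model_types \<Phi> I \<Theta> F \<pi> i)"

definition joint_desc ::
  "'p set \<Rightarrow> 'i set \<Rightarrow> real set \<Rightarrow> ('p, 'i) fm set \<Rightarrow> ('i \<Rightarrow> ('p, 'i) fm set)
     \<Rightarrow> ('p, 'i) fm set" where
  "joint_desc \<Phi> I \<Theta> x t = (THE D. description \<Phi> I \<Theta> D \<and> x \<union> (\<Union>i\<in>I. t i) \<subseteq> D)"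

definition formula_event ::
  "'p set \<Rightarrow> 'i set \<Rightarrow> real set \<Rightarrow> ('w, 'i) prob_structure \<Rightarrow> ('p \<Rightarrow> 'w set) \<Rightarrow> ('p, 'i) fm
     \<Rightarrow> (('p, 'i) fm set \<times> ('i \<Rightarrow> ('p, 'i) fm set)) set" where
  "formula_event \<Phi> I \<Theta> F \<pi> \<phi> =
     {(x, t) \<in> space (model_product \<Phi> I \<Theta> F \<pi>). \<phi> \<in> joint_desc \<Phi> I \<Theta> x t}"

definition model_beta ::
  "'p set \<Rightarrow> 'i set \<Rightarrow> real set \<Rightarrow> ('w, 'i) prob_structure \<Rightarrow> ('p \<Rightarrow> 'w set) \<Rightarrow> 'i
     \<Rightarrow> ('p, 'i) fm set \<Rightarrow> (('p, 'i) fm set \<times> ('i \<Rightarrow> ('p, 'i) fm set)) measure" where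
  "model_beta \<Phi> I \<Theta> F \<pi> i s =
     (THE \<mu>. \<mu> \<in> space (prob_algebra (model_product \<Phi> I \<Theta> F \<pi>)) \<and>
        (\<forall>\<phi>\<in>lang \<Phi> I \<Theta>. \<forall>\<theta>\<in>\<Theta>.
           measure \<mu> (formula_event \<Phi> I \<Theta> F \<pi> \<phi>) \<ge> \<theta> \<longleftrightarrow> Bel i \<theta> \<phi> \<in> s))"

definition model_type_space ::
  "'p set \<Rightarrow> 'i set \<Rightarrow> real set \<Rightarrow> ('w, 'i) prob_structure \<Rightarrow> ('p \<Rightarrow> 'w set)
     \<Rightarrow> (('p, 'i) fm set, ('p, 'i) fm set, 'i) type_structure" where
  "model_type_space \<Phi> I \<Theta> F \<pi> =
     \<lparr>states = model_states \<Phi> I \<Theta> F \<pi>, types = model_types \<Phi> I \<Theta> F \<pi>,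
      beta = model_beta \<Phi> I \<Theta> F \<pi>\<rparr>"

definition model_val ::
  "'p set \<Rightarrow> 'i set \<Rightarrow> real set \<Rightarrow> ('w, 'i) prob_structure \<Rightarrow> ('p \<Rightarrow> 'w set) \<Rightarrow> 'p
     \<Rightarrow> ('p, 'i) fm set set" where
  "model_val \<Phi> I \<Theta> F \<pi> p = {x \<in> space (model_states \<Phi> I \<Theta> F \<pi>). Prop p \<in> x}"

end

theory Submission
  imports Defs
begin

text \<open>
  The key point is that a propositional description and the descriptions of the individual agents
  can be combined freely: to a model one adds a world that has the atomic facts of a world
  \<open>w\<^sub>0\<close> and in which each agent \<open>i\<close> has the beliefs of a world \<open>w i\<close>.  These beliefs still live on
  the old worlds, so old truth values do not change and the introspection condition survives.
  Hence joint descriptions exist, and by induction on formulas they are unique.  The events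
  \<open>[\<phi>]\<close> are closed under intersection and generate the product \<open>\<sigma>\<close>-algebra, so the measure
  \<open>\<beta>\<^sub>i(d\<^sub>i(\<omega>))\<close> is the image of \<open>Pr\<^sub>i(\<omega>)\<close> under \<open>\<omega>' \<mapsto> (d\<^sub>0(\<omega>'), d(\<omega>'))\<close>.  Its marginal on \<open>T\<^sub>i\<close> is a
  point mass because \<open>d\<^sub>i\<close> is constant on the set of worlds where agent \<open>i\<close> has the beliefs
  \<open>Pr\<^sub>i(\<omega>)\<close>, a set of outer measure one.
\<close>

section \<open>Descriptions\<close>

lemma lang_mono: "\<Theta> \<subseteq> \<Theta>' \<Longrightarrow> lang \<Phi> I \<Theta> \<subseteq> lang \<Phi> I \<Theta>'"
proof
  fix \<phi> assume "\<phi> \<in> lang \<Phi> I \<Theta>" "\<Theta> \<subseteq> \<Theta>'"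
  then show "\<phi> \<in> lang \<Phi> I \<Theta>'"
    by induction (auto intro: lang.intros)
qed

lemma description_world_desc:
  fixes F :: "('w, 'i) prob_structure"
  assumes "probability_model \<Phi> I F \<pi>" and "\<omega> \<in> space (worlds F)"
  shows "description \<Phi> I \<Theta> (world_desc \<Phi> I \<Theta> F \<pi> \<omega>)"
proof -
  have "satisfiable_on TYPE('w) \<Phi> I (world_desc \<Phi> I \<Theta> F \<pi> \<omega>)"
    unfolding satisfiable_on_def using assms unfolding world_desc_def by blast
  moreover have "world_desc \<Phi> I \<Theta> F \<pi> \<omega> \<subseteq> lang \<Phi> I UNIV"
    using lang_mono[of \<Theta> UNIV] by (auto simp: world_desc_def)
  ultimately have "satisfiable \<Phi> I (world_desc \<Phi> I \<Theta> F \<pi> \<omega>)"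
    by (rule satisfiable_on_imp_satisfiable)
  then show ?thesis
    using assms by (auto simp: description_def world_desc_def intro: lang.intros)
qed

text \<open>By completeness, a formula true at the satisfying world but missing from
  \<open>D\<close> would have its negation in \<open>D\<close>, false at that world. Closure
  properties of descriptions can then be read off truth at a world.\<close>

lemma description_imp_world_desc:
  fixes D :: "('p, 'i) fm set"
  assumes "description \<Phi> I \<Theta> D"
  obtains F :: "(('p, 'i) fm set, 'i) prob_structure" and \<pi> \<omega>
  where "probability_model \<Phi> I F \<pi>" "\<omega> \<in> space (worlds F)" "D = world_desc \<Phi> I \<Theta> F \<pi> \<omega>"
proof -
  from assms obtain F :: "(('p, 'i) fm set, 'i) prob_structure" and \<pi> \<omega>
    where m: "probability_model \<Phi> I F \<pi>" and w: "\<omega> \<in> space (worlds F)"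
      and t: "\<forall>\<phi>\<in>D. \<omega> \<in> truth F \<pi> \<phi>"
    unfolding description_def satisfiable_def satisfiable_on_def by blast
  have "D = world_desc \<Phi> I \<Theta> F \<pi> \<omega>"
  proof (intro equalityI subsetI)
    fix \<phi> assume "\<phi> \<in> D"
    then show "\<phi> \<in> world_desc \<Phi> I \<Theta> F \<pi> \<omega>"
      using t assms by (auto simp: description_def world_desc_def)
  next
    fix \<phi> assume \<phi>: "\<phi> \<in> world_desc \<Phi> I \<Theta> F \<pi> \<omega>"
    then have "Neg \<phi> \<notin> D" using t by (force simp: world_desc_def)
    then show "\<phi> \<in> D" using \<phi> assms by (auto simp: description_def world_desc_def)
  qed
  with m w show ?thesis by (rule that)
qed

lemma description_Neg:
  assumes "description \<Phi> I \<Theta> D" and "\<phi> \<in> lang \<Phi> I \<Theta>"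
  shows "Neg \<phi> \<in> D \<longleftrightarrow> \<phi> \<notin> D"
  using assms(1)
  by (rule description_imp_world_desc) (use assms(2) in \<open>auto simp: world_desc_def intro: lang.intros\<close>)

lemma description_Conj:
  assumes "description \<Phi> I \<Theta> D" and "\<phi> \<in> lang \<Phi> I \<Theta>" and "\<psi> \<in> lang \<Phi> I \<Theta>"
  shows "Conj \<phi> \<psi> \<in> D \<longleftrightarrow> \<phi> \<in> D \<and> \<psi> \<in> D"
  using assms(1)
  by (rule description_imp_world_desc) (use assms(2,3) in \<open>auto simp: world_desc_def intro: lang.intros\<close>)

text \<open>One inclusion is enough because Boolean combinations are closed under negation: if
  \<open>\<phi>\<close> is absent from \<open>D'\<close>, then \<open>Neg \<phi>\<close> is in
  \<open>D'\<close>, hence in \<open>D\<close>, and excludes \<open>\<phi>\<close>.\<close>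

lemma description_determined:
  assumes "description \<Phi> I \<Theta> D" and "description \<Phi> I \<Theta> D'"
    and "{\<phi> \<in> D'. \<phi> \<in> bool_comb A} \<subseteq> D" and "\<phi> \<in> lang \<Phi> I \<Theta>" and "\<phi> \<in> bool_comb A"
  shows "\<phi> \<in> D \<longleftrightarrow> \<phi> \<in> D'"
  using description_Neg[OF assms(1,4)] description_Neg[OF assms(2,4)] assms(3,5)
    bool_comb.intros(2)[OF assms(5)] by blast

lemma description_eqI:
  assumes D: "description \<Phi> I \<Theta> D" and D': "description \<Phi> I \<Theta> D'"
    and "\<And>p. p \<in> \<Phi> \<Longrightarrow> Prop p \<in> D \<longleftrightarrow> Prop p \<in> D'"
    and "\<And>i \<theta> \<phi>. i \<in> I \<Longrightarrow> \<theta> \<in> \<Theta> \<Longrightarrow> \<phi> \<in> lang \<Phi> I \<Theta> \<Longrightarrow> Bel i \<theta> \<phi> \<in> D \<longleftrightarrow> Bel i \<theta> \<phi> \<in> D'"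
  shows "D = D'"
proof -
  have "\<phi> \<in> D \<longleftrightarrow> \<phi> \<in> D'" if "\<phi> \<in> lang \<Phi> I \<Theta>" for \<phi>
    using that
    by induction (simp_all add: assms description_Neg[OF D] description_Neg[OF D']
        description_Conj[OF D] description_Conj[OF D'])
  then show ?thesis using D D' by (auto simp: description_def)
qed


section \<open>Adding a world\<close>

lemma emeasure_eq_1_of_outer:
  assumes "prob_space M" and "outer_measure_of M A = 1" and "A \<subseteq> B" and "B \<in> sets M"
  shows "emeasure M B = 1"
proof (rule antisym)
  show "emeasure M B \<le> 1" by (rule prob_space.emeasure_le_1) fact
  show "1 \<le> emeasure M B"
    using outer_measure_of_mono[OF assms(3), of M] assms(2,4) by simp
qed

text \<open>Every measurable superset of \<open>B\<close> pulls back to a measurable superset of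
  \<open>A\<close>, which has probability one. This carries the introspection condition along a
  pushforward.\<close>

lemma outer_measure_of_distr_eq_1:
  assumes f: "f \<in> measurable M N" and M: "prob_space M" and A: "outer_measure_of M A = 1"
    and sub: "f ` A \<subseteq> B" "A \<subseteq> space M" and B: "B \<subseteq> space N"
  shows "outer_measure_of (distr M N f) B = 1"
proof (rule antisym)
  interpret d: prob_space "distr M N f"
    using M f by (rule prob_space.prob_space_distr)
  have "outer_measure_of (distr M N f) B \<le> outer_measure_of (distr M N f) (space N)"
    using B by (rule outer_measure_of_mono)
  also have "\<dots> = 1"
    using d.emeasure_space_1 by (metis outer_measure_of_eq sets.top space_distr)
  finally show "outer_measure_of (distr M N f) B \<le> 1" .
  show "1 \<le> outer_measure_of (distr M N f) B"
    unfolding outer_measure_of_def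
  proof (rule INF_greatest)
    fix E assume "E \<in> {E \<in> sets (distr M N f). B \<subseteq> E}"
    then have E: "E \<in> sets N" "B \<subseteq> E" by auto
    then have "emeasure M (f -` E \<inter> space M) = 1"
      using f sub by (intro emeasure_eq_1_of_outer[OF M A]) auto
    then show "1 \<le> emeasure (distr M N f) E" using E f by (simp add: emeasure_distr)
  qed
qed

text \<open>
  The worlds \<open>(False, \<omega>)\<close> are the old ones.  Instead of one new world there is a copy \<open>(True, \<omega>)\<close>
  for each \<open>\<omega>\<close>, all alike, since the product with a discrete space comes with ready measurability.
\<close>

definition ext_structure :: "('w, 'i) prob_structure \<Rightarrow> ('i \<Rightarrow> 'w) \<Rightarrow> (bool \<times> 'w, 'i) prob_structure" where
  "ext_structure F w = (let N = count_space UNIV \<Otimes>\<^sub>M worlds F in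
     \<lparr>worlds = N, Pr = (\<lambda>i (b, v). distr (Pr F i (if b then w i else v)) N (Pair False))\<rparr>)"

definition ext_val :: "('w, 'i) prob_structure \<Rightarrow> ('p \<Rightarrow> 'w set) \<Rightarrow> 'w \<Rightarrow> 'p \<Rightarrow> (bool \<times> 'w) set" where
  "ext_val F \<pi> w\<^sub>0 p = {(b, v). v \<in> space (worlds F) \<and> (if b then w\<^sub>0 else v) \<in> \<pi> p}"

lemma worlds_ext_structure:
  "worlds (ext_structure F w) = count_space UNIV \<Otimes>\<^sub>M worlds F"
  by (simp add: ext_structure_def Let_def)

lemma Pr_ext_structure:
  "Pr (ext_structure F w) i (b, v) =
     distr (Pr F i (if b then w i else v)) (count_space UNIV \<Otimes>\<^sub>M worlds F) (Pair False)"
  by (simp add: ext_structure_def Let_def)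

lemma probability_model_ext:
  assumes model: "probability_model \<Phi> I F \<pi>" and w0: "w\<^sub>0 \<in> space (worlds F)"
    and w: "\<And>i. i \<in> I \<Longrightarrow> w i \<in> space (worlds F)"
  shows "probability_model \<Phi> I (ext_structure F w) (ext_val F \<pi> w\<^sub>0)"
proof -
  define \<Omega> where "\<Omega> = worlds F"
  define N where "N = (count_space UNIV :: bool measure) \<Otimes>\<^sub>M \<Omega>"
  have N: "worlds (ext_structure F w) = N"
    by (simp add: worlds_ext_structure N_def \<Omega>_def)
  have Pr: "Pr F i \<in> measurable \<Omega> (prob_algebra \<Omega>)" if "i \<in> I" for i
    using model that by (simp add: probability_model_def probability_frame_def \<Omega>_def)
  have pair: "Pair False \<in> measurable \<Omega> N" unfolding N_def by measurable
  have sel: "(\<lambda>(b, v). if b then u else v) \<in> measurable N \<Omega>" if "u \<in> space \<Omega>" for u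
    unfolding N_def case_prod_beta using that by measurable
  \<comment> \<open>As a composition of three maps the kernel is measurable: choose the old world
    whose beliefs count, take its measure, push it forward to the copies marked
    \<open>False\<close>.\<close>
  have PrN: "Pr (ext_structure F w) i
      = (\<lambda>M. distr M N (Pair False)) \<circ> (Pr F i \<circ> (\<lambda>(b, v). if b then w i else v))" for i
    by (auto simp: fun_eq_iff Pr_ext_structure N_def \<Omega>_def)
  have "Pr (ext_structure F w) i \<in> measurable N (prob_algebra N)" if "i \<in> I" for i
    unfolding PrN using that w
    by (intro measurable_comp[OF measurable_comp[OF sel Pr] measurable_distr_prob_space[OF pair]])
      (auto simp: \<Omega>_def)
  moreover have "outer_measure_of (Pr (ext_structure F w) i z)
      {z' \<in> space N. Pr (ext_structure F w) i z' = Pr (ext_structure F w) i z} = 1"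
    if i: "i \<in> I" and z: "z \<in> space N" for i z
  proof -
    obtain b v where bv: "z = (b, v)" by (cases z)
    define u where "u = (if b then w i else v)"
    have u: "u \<in> space \<Omega>" using z w[OF i] bv by (auto simp: u_def N_def \<Omega>_def space_pair_measure)
    have P: "prob_space (Pr F i u)" "sets (Pr F i u) = sets \<Omega>"
      using measurable_space[OF Pr[OF i] u] by (auto simp: space_prob_algebra)
    have Prz: "Pr (ext_structure F w) i z = distr (Pr F i u) N (Pair False)"
      by (simp add: bv u_def PrN)
    \<comment> \<open>The old worlds sharing the beliefs of \<open>u\<close> have outer measure one,
      and \<open>Pair False\<close> maps them into the worlds with the same new measure as
      \<open>z\<close>.\<close>
    show ?thesis unfolding Prz
    proof (rule outer_measure_of_distr_eq_1[OF _ P(1)])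
      show "Pair False \<in> measurable (Pr F i u) N"
        using pair P(2) by (simp cong: measurable_cong_sets)
      show "outer_measure_of (Pr F i u) {u' \<in> space \<Omega>. Pr F i u' = Pr F i u} = 1"
        using model i u by (simp add: probability_model_def probability_frame_def \<Omega>_def)
    qed (use P(2) in \<open>auto simp: N_def space_pair_measure PrN dest: sets_eq_imp_space_eq\<close>)
  qed
  moreover have "ext_val F \<pi> w\<^sub>0 p \<in> sets N" if "p \<in> \<Phi>" for p
  proof -
    have "ext_val F \<pi> w\<^sub>0 p = (\<lambda>(b, v). if b then w\<^sub>0 else v) -` \<pi> p \<inter> space N"
      by (auto simp: ext_val_def N_def \<Omega>_def space_pair_measure)
    moreover have "\<pi> p \<in> sets \<Omega>"
      using model that by (simp add: probability_model_def \<Omega>_def)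
    ultimately show ?thesis
      using measurable_sets[OF sel] w0 by (simp add: \<Omega>_def)
  qed
  ultimately show ?thesis
    unfolding probability_model_def probability_frame_def N by blast
qed

text \<open>All measures of the extension live on the old copies, where truth is unchanged, so a new
  world assigns \<open>\<phi>\<close> exactly the probability that \<open>w i\<close> assigns
  it.\<close>

lemma truth_ext_Bel:
  assumes model: "probability_model \<Phi> I F \<pi>" and w0: "w\<^sub>0 \<in> space (worlds F)"
    and w: "\<And>i. i \<in> I \<Longrightarrow> w i \<in> space (worlds F)"
    and B: "Bel i \<theta> \<phi> \<in> lang \<Phi> I \<Theta>" and v: "v \<in> space (worlds F)"
  shows "(True, v) \<in> truth (ext_structure F w) (ext_val F \<pi> w\<^sub>0) (Bel i \<theta> \<phi>) \<longleftrightarrow>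
    w i \<in> truth F \<pi> (Bel i \<theta> \<phi>)"
proof -
  let ?F = "ext_structure F w" and ?\<pi> = "ext_val F \<pi> w\<^sub>0"
  let ?N = "count_space UNIV \<Otimes>\<^sub>M worlds F"
  \<comment> \<open>Invariance on the old copies is a premise here because the fact is used twice:
    in the induction proving \<open>old\<close>, where invariance is the induction hypothesis, and
    afterwards for the new copies.\<close>
  have meas: "measure (Pr ?F i (b, v)) (truth ?F ?\<pi> \<phi>) =
      measure (Pr F i (if b then w i else v)) (truth F \<pi> \<phi>)"
    if \<phi>: "\<phi> \<in> lang \<Phi> I \<Theta>" and i: "i \<in> I" and v: "v \<in> space (worlds F)"
      and old: "\<And>v. v \<in> space (worlds F) \<Longrightarrow> (False, v) \<in> truth ?F ?\<pi> \<phi> \<longleftrightarrow> v \<in> truth F \<pi> \<phi>"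
    for \<phi> i b v
  proof -
    define u where "u = (if b then w i else v)"
    have u: "u \<in> space (worlds F)" using v w[OF i] by (simp add: u_def)
    have "Pr F i \<in> measurable (worlds F) (prob_algebra (worlds F))"
      using model i by (simp add: probability_model_def probability_frame_def)
    from measurable_space[OF this u] have P: "sets (Pr F i u) = sets (worlds F)"
      by (simp add: space_prob_algebra)
    have "Pair False \<in> measurable (worlds F) ?N" by measurable
    then have pair: "Pair False \<in> measurable (Pr F i u) ?N"
      using P by (simp cong: measurable_cong_sets)
    have "truth ?F ?\<pi> \<phi> \<in> sets ?N"
      using truth_in_sets[OF probability_model_ext[OF model w0 w] \<phi>]
      by (simp add: worlds_ext_structure)
    then have "measure (Pr ?F i (b, v)) (truth ?F ?\<pi> \<phi>)
        = measure (Pr F i u) (Pair False -` truth ?F ?\<pi> \<phi> \<inter> space (worlds F))"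
      using pair sets_eq_imp_space_eq[OF P] by (simp add: Pr_ext_structure measure_distr u_def)
    also have "Pair False -` truth ?F ?\<pi> \<phi> \<inter> space (worlds F) = truth F \<pi> \<phi>"
      using old sets.sets_into_space[OF truth_in_sets[OF model \<phi>]] by auto
    finally show ?thesis by (simp add: u_def)
  qed
  have old: "(False, v) \<in> truth ?F ?\<pi> \<phi> \<longleftrightarrow> v \<in> truth F \<pi> \<phi>"
    if "\<phi> \<in> lang \<Phi> I \<Theta>" "v \<in> space (worlds F)" for \<phi> v
    using that
  proof (induction arbitrary: v)
    case (1 p)
    then show ?case by (simp add: ext_val_def)
  next
    case (4 \<phi> i \<theta>)
    then show ?case using meas by (simp add: worlds_ext_structure space_pair_measure)
  qed (auto simp: worlds_ext_structure space_pair_measure)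
  from B have "i \<in> I" "\<phi> \<in> lang \<Phi> I \<Theta>" by (auto elim: lang.cases)
  then show "(True, v) \<in> truth ?F ?\<pi> (Bel i \<theta> \<phi>) \<longleftrightarrow> w i \<in> truth F \<pi> (Bel i \<theta> \<phi>)"
    using meas old v w by (simp add: worlds_ext_structure space_pair_measure)
qed


section \<open>Formula spaces\<close>

lemma space_formula_space [simp]: "space (formula_space \<Phi> I \<Theta> Y) = Y"
  by (auto simp: formula_space_def intro!: space_measure_of)

lemma formula_space_event:
  assumes "\<phi> \<in> lang \<Phi> I \<Theta>"
  shows "{y \<in> Y. \<phi> \<in> y} \<in> sets (formula_space \<Phi> I \<Theta> Y)"
proof -
  have "{{y \<in> Y. \<phi> \<in> y} | \<phi>. \<phi> \<in> lang \<Phi> I \<Theta>} \<subseteq> Pow Y" by auto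
  then show ?thesis
    using assms by (auto simp: formula_space_def sets_measure_of)
qed

lemma measurable_formula_space:
  assumes "f \<in> space M \<rightarrow> Y"
    and "\<And>\<phi>. \<phi> \<in> lang \<Phi> I \<Theta> \<Longrightarrow> {z \<in> space M. \<phi> \<in> f z} \<in> sets M"
  shows "f \<in> measurable M (formula_space \<Phi> I \<Theta> Y)"
  unfolding formula_space_def
proof (rule measurable_measure_of)
  fix E assume "E \<in> {{y \<in> Y. \<phi> \<in> y} | \<phi>. \<phi> \<in> lang \<Phi> I \<Theta>}"
  then obtain \<phi> where \<phi>: "\<phi> \<in> lang \<Phi> I \<Theta>" and E: "E = {y \<in> Y. \<phi> \<in> y}" by auto
  have "f -` E \<inter> space M = {z \<in> space M. \<phi> \<in> f z}" using assms(1) E by auto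
  then show "f -` E \<inter> space M \<in> sets M" using assms(2)[OF \<phi>] by simp
qed (use assms(1) in auto)

section \<open>Thresholds from a dense set\<close>

lemma dense_between:
  fixes u v :: real
  assumes "{0..1} \<subseteq> closure \<Theta>" and "u < v" "0 \<le> u" "v \<le> 1"
  shows "\<exists>\<theta>\<in>\<Theta>. u < \<theta> \<and> \<theta> < v"
proof -
  have "(u + v) / 2 \<in> closure \<Theta>" using assms by (intro subsetD[OF assms(1)]) auto
  moreover have "0 < (v - u) / 2" using assms by simp
  ultimately obtain \<theta> where "\<theta> \<in> \<Theta>" "dist \<theta> ((u + v) / 2) < (v - u) / 2"
    unfolding closure_approachable by blast
  then show ?thesis
    by (intro bexI[of _ \<theta>]) (auto simp: dist_real_def abs_less_iff field_simps)
qed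

text \<open>A threshold strictly between two distinct numbers is met by the larger only. Thus belief
  formulas fix a probability even if its value does not lie in \<open>\<Theta>\<close>.\<close>

lemma dense_threshold_eqI:
  fixes a b :: real
  assumes "{0..1} \<subseteq> closure \<Theta>" and "0 \<le> a" "a \<le> 1" "0 \<le> b" "b \<le> 1"
    and iff: "\<And>\<theta>. \<theta> \<in> \<Theta> \<Longrightarrow> \<theta> \<le> a \<longleftrightarrow> \<theta> \<le> b"
  shows "a = b"
proof -
  have "\<not> u < v" if "0 \<le> u" "v \<le> 1" "\<And>\<theta>. \<theta> \<in> \<Theta> \<Longrightarrow> \<theta> \<le> u \<longleftrightarrow> \<theta> \<le> v" for u v
    using dense_between[OF assms(1), of u v] that by force
  from this[of a b] this[of b a] show ?thesis using assms by force
qed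


section \<open>The type space of a probability model\<close>

locale model_language =
  fixes \<Phi> :: "'p set" and I :: "'i set" and \<Theta> :: "real set"
    and F :: "('w, 'i) prob_structure" and \<pi> :: "'p \<Rightarrow> 'w set"
  assumes model: "probability_model \<Phi> I F \<pi>"
begin

abbreviation "\<L> \<equiv> lang \<Phi> I \<Theta>"
abbreviation "\<Omega> \<equiv> worlds F"
abbreviation "d\<^sub>0 \<equiv> state_desc \<Phi> I \<Theta> F \<pi>"
abbreviation "d\<^sub>a \<equiv> agent_desc \<Phi> I \<Theta> F \<pi>"
abbreviation "d \<equiv> profile_desc \<Phi> I \<Theta> F \<pi>"
abbreviation "X \<equiv> model_states \<Phi> I \<Theta> F \<pi>"
abbreviation "T \<equiv> model_types \<Phi> I \<Theta> F \<pi>"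
abbreviation "XT \<equiv> model_product \<Phi> I \<Theta> F \<pi>"
abbreviation "joint \<equiv> joint_desc \<Phi> I \<Theta>"
abbreviation "evt \<equiv> formula_event \<Phi> I \<Theta> F \<pi>"
abbreviation "\<beta> \<equiv> model_beta \<Phi> I \<Theta> F \<pi>"
abbreviation "bel_atoms i \<equiv> {Bel i \<theta> \<psi> | \<theta> \<psi>. \<theta> \<in> \<Theta> \<and> \<psi> \<in> \<L>}"

lemma Pr_measurable: "i \<in> I \<Longrightarrow> Pr F i \<in> measurable \<Omega> (prob_algebra \<Omega>)"
  using model by (simp add: probability_model_def probability_frame_def)

lemma
  assumes "i \<in> I" and "\<omega> \<in> space \<Omega>"
  shows prob_space_Pr: "prob_space (Pr F i \<omega>)" and sets_Pr: "sets (Pr F i \<omega>) = sets \<Omega>"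
    and space_Pr: "space (Pr F i \<omega>) = space \<Omega>"
  using measurable_space[OF Pr_measurable[OF assms(1)] assms(2)]
  by (auto simp: space_prob_algebra dest: sets_eq_imp_space_eq)

lemma space_states: "space X = d\<^sub>0 ` space \<Omega>"
  and space_types: "space (T i) = d\<^sub>a i ` space \<Omega>"
  by (simp_all add: model_states_def model_types_def)

lemma space_XT_iff:
  "(x, t) \<in> space XT \<longleftrightarrow> x \<in> d\<^sub>0 ` space \<Omega> \<and> t \<in> (\<Pi>\<^sub>E i\<in>I. d\<^sub>a i ` space \<Omega>)"
  by (simp add: model_product_def space_pair_measure space_PiM space_states space_types)

lemma XT_component: "z \<in> space XT \<Longrightarrow> i \<in> I \<Longrightarrow> snd z i \<in> d\<^sub>a i ` space \<Omega>"
  by (cases z) (auto simp: space_XT_iff simp del: image_iff dest: PiE_mem)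

lemma desc_in_XT: "\<omega> \<in> space \<Omega> \<Longrightarrow> (d\<^sub>0 \<omega>, d \<omega>) \<in> space XT"
  by (simp add: space_XT_iff profile_desc_def)

section \<open>Existence and uniqueness of joint descriptions\<close>

lemma ex1_joint_desc:
  assumes "(x, t) \<in> space XT"
  shows "\<exists>!D. description \<Phi> I \<Theta> D \<and> x \<union> (\<Union>i\<in>I. t i) \<subseteq> D"
proof -
  from assms obtain w\<^sub>0 where w0: "w\<^sub>0 \<in> space \<Omega>" and x: "x = d\<^sub>0 w\<^sub>0"
    by (auto simp: space_XT_iff)
  from assms have "\<forall>i\<in>I. \<exists>w. w \<in> space \<Omega> \<and> t i = d\<^sub>a i w"
    by (auto simp: space_XT_iff PiE_def Pi_def)
  then obtain w where w: "\<And>i. i \<in> I \<Longrightarrow> w i \<in> space \<Omega>" and t: "\<And>i. i \<in> I \<Longrightarrow> t i = d\<^sub>a i (w i)"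
    by metis
  let ?F = "ext_structure F w" and ?\<pi> = "ext_val F \<pi> w\<^sub>0"
  have new: "(True, w\<^sub>0) \<in> space (worlds ?F)"
    using w0 by (simp add: worlds_ext_structure space_pair_measure)
  \<comment> \<open>The witness is the new world built from the chosen representatives. The second
    component of \<open>(True, w\<^sub>0)\<close> only has to be some old world.\<close>
  define D where "D = world_desc \<Phi> I \<Theta> ?F ?\<pi> (True, w\<^sub>0)"
  have D: "description \<Phi> I \<Theta> D"
    unfolding D_def using probability_model_ext[OF model w0 w] new by (rule description_world_desc)
  have state: "(True, w\<^sub>0) \<in> truth ?F ?\<pi> \<phi> \<longleftrightarrow> w\<^sub>0 \<in> truth F \<pi> \<phi>"
    if "\<phi> \<in> bool_comb (Prop ` \<Phi>)" for \<phi>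
    using that by induction (use w0 new in \<open>auto simp: ext_val_def\<close>)
  have agent: "(True, w\<^sub>0) \<in> truth ?F ?\<pi> \<phi> \<longleftrightarrow> w i \<in> truth F \<pi> \<phi>"
    if "\<phi> \<in> bool_comb (bel_atoms i)" and i: "i \<in> I" for \<phi> i
    using that(1)
  proof induction
    case (1 \<phi>)
    then obtain \<theta> \<psi> where \<phi>: "\<phi> = Bel i \<theta> \<psi>" and "\<theta> \<in> \<Theta>" "\<psi> \<in> \<L>" by auto
    then have "Bel i \<theta> \<psi> \<in> \<L>" using i by (simp add: lang.intros)
    then show ?case
      unfolding \<phi> using truth_ext_Bel[where w = w and v = w\<^sub>0, OF model w0 w _ w0] by blast
  qed (use w[OF i] new in auto)
  have sub: "x \<union> (\<Union>i\<in>I. t i) \<subseteq> D"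
    using state agent t by (auto simp: x D_def state_desc_def agent_desc_def world_desc_def)
  show ?thesis
  proof (rule ex1I[of _ D])
    fix D' assume D': "description \<Phi> I \<Theta> D' \<and> x \<union> (\<Union>i\<in>I. t i) \<subseteq> D'"
    \<comment> \<open>Both \<open>D'\<close> and \<open>D\<close> contain the combinations of
      \<open>A\<close> true at \<open>v\<close>, so each agrees with \<open>v\<close> on such
      combinations, and hence with the other.\<close>
    have det: "\<phi> \<in> D' \<longleftrightarrow> \<phi> \<in> D"
      if "\<phi> \<in> \<L>" "\<phi> \<in> bool_comb A" "v \<in> space \<Omega>"
        "{\<phi> \<in> world_desc \<Phi> I \<Theta> F \<pi> v. \<phi> \<in> bool_comb A} \<subseteq> D' \<inter> D" for \<phi> A v
      using description_determined[OF D description_world_desc[OF model that(3)] _ that(1,2)]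
        description_determined[OF conjunct1[OF D'] description_world_desc[OF model that(3)] _ that(1,2)]
        that(4) by blast
    show "D' = D"
    proof (rule description_eqI[OF conjunct1[OF D'] D])
      fix p assume "p \<in> \<Phi>"
      then show "Prop p \<in> D' \<longleftrightarrow> Prop p \<in> D"
        using D' sub x by (intro det[where A = "Prop ` \<Phi>", OF _ _ w0])
          (auto simp: state_desc_def intro: lang.intros bool_comb.intros)
    next
      fix i \<theta> \<phi> assume "i \<in> I" "\<theta> \<in> \<Theta>" "\<phi> \<in> \<L>"
      then show "Bel i \<theta> \<phi> \<in> D' \<longleftrightarrow> Bel i \<theta> \<phi> \<in> D"
        using D' sub t by (intro det[where A = "bel_atoms i", OF _ _ w])
          (auto simp: agent_desc_def intro: lang.intros bool_comb.intros)
    qed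
  qed (use D sub in auto)
qed

lemma
  assumes "(x, t) \<in> space XT"
  shows description_joint: "description \<Phi> I \<Theta> (joint x t)"
    and joint_superset: "x \<union> (\<Union>i\<in>I. t i) \<subseteq> joint x t"
  using theI'[OF ex1_joint_desc[OF assms]] unfolding joint_desc_def by auto

text \<open>Inclusion of \<open>x\<close> gives one direction; for the other, \<open>x\<close> comes
  from a world and so contains the negation of each propositional formula it omits.\<close>

lemma joint_state:
  assumes xt: "(x, t) \<in> space XT" and "\<phi> \<in> \<L>" "\<phi> \<in> bool_comb (Prop ` \<Phi>)"
  shows "\<phi> \<in> joint x t \<longleftrightarrow> \<phi> \<in> x"
proof -
  from xt obtain w where w: "w \<in> space \<Omega>" and x: "x = d\<^sub>0 w" by (auto simp: space_XT_iff)
  show ?thesis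
    using description_determined[OF description_joint[OF xt] description_world_desc[OF model w]
        _ assms(2,3)]
      joint_superset[OF xt] assms(3) by (auto simp: x state_desc_def)
qed

lemma joint_agent:
  assumes xt: "(x, t) \<in> space XT" and i: "i \<in> I" and "\<phi> \<in> \<L>" "\<phi> \<in> bool_comb (bel_atoms i)"
  shows "\<phi> \<in> joint x t \<longleftrightarrow> \<phi> \<in> t i"
proof -
  from xt i obtain w where w: "w \<in> space \<Omega>" and t: "t i = d\<^sub>a i w" by (auto simp: space_XT_iff PiE_def Pi_def)
  have "d\<^sub>a i w \<subseteq> joint x t" using joint_superset[OF xt] i t by auto
  then show ?thesis
    using description_determined[OF description_joint[OF xt] description_world_desc[OF model w]
        _ assms(3,4)]
      assms(4) unfolding t by (auto simp: agent_desc_def)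
qed

lemma joint_Bel:
  assumes "(x, t) \<in> space XT" and "i \<in> I" "\<theta> \<in> \<Theta>" "\<phi> \<in> \<L>"
  shows "Bel i \<theta> \<phi> \<in> joint x t \<longleftrightarrow> Bel i \<theta> \<phi> \<in> t i"
  using assms by (intro joint_agent) (auto intro: lang.intros bool_comb.intros)

text \<open>The description of the world contains its own state and types, so uniqueness identifies
  it as their joint description. This is the bridge from the model to the type space.\<close>

lemma joint_desc_world:
  assumes "\<omega> \<in> space \<Omega>"
  shows "joint (d\<^sub>0 \<omega>) (d \<omega>) = world_desc \<Phi> I \<Theta> F \<pi> \<omega>"
  unfolding joint_desc_def
  by (rule the1_equality[OF ex1_joint_desc[OF desc_in_XT[OF assms]]])
    (use description_world_desc[OF model assms] in
      \<open>auto simp: state_desc_def profile_desc_def agent_desc_def\<close>)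

section \<open>The events \<open>evt \<phi>\<close> and the product \<sigma>-algebra\<close>

lemma formula_event_subset: "evt \<phi> \<subseteq> space XT"
  by (auto simp: formula_event_def)

lemma formula_event_Neg: "\<phi> \<in> \<L> \<Longrightarrow> evt (Neg \<phi>) = space XT - evt \<phi>"
  by (auto simp: formula_event_def description_Neg[OF description_joint])

lemma formula_event_Conj: "\<phi> \<in> \<L> \<Longrightarrow> \<psi> \<in> \<L> \<Longrightarrow> evt (Conj \<phi> \<psi>) = evt \<phi> \<inter> evt \<psi>"
  by (auto simp: formula_event_def description_Conj[OF description_joint])

text \<open>Through \<open>joint_desc_world\<close>, events on descriptions become truth sets; this
  yields measurability of the description map and computes its image measures.\<close>

lemma vimage_formula_event:
  assumes "\<phi> \<in> \<L>"
  shows "(\<lambda>\<omega>. (d\<^sub>0 \<omega>, d \<omega>)) -` evt \<phi> \<inter> space \<Omega> = truth F \<pi> \<phi>"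
  using assms sets.sets_into_space[OF truth_in_sets[OF model assms]]
  by (auto simp: formula_event_def joint_desc_world world_desc_def desc_in_XT)

text \<open>States hold propositional formulas only, so the generator of \<open>X\<close> given by
  any other formula is empty. The case split lets \<open>\<phi>\<close> range over the whole
  language, as the generators do.\<close>

lemma fst_vimage:
  assumes "\<phi> \<in> \<L>"
  shows "{z \<in> space XT. \<phi> \<in> fst z} = (if \<phi> \<in> bool_comb (Prop ` \<Phi>) then evt \<phi> else {})"
  using assms by (auto simp: formula_event_def joint_state) (auto simp: space_XT_iff state_desc_def)

lemma snd_vimage:
  assumes "\<phi> \<in> \<L>" "i \<in> I"
  shows "{z \<in> space XT. \<phi> \<in> snd z i} = (if \<phi> \<in> bool_comb (bel_atoms i) then evt \<phi> else {})"
proof -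
  have "t i \<subseteq> bool_comb (bel_atoms i)" if "(x, t) \<in> space XT" for x t
  proof -
    from that have "t i \<in> d\<^sub>a i ` space \<Omega>" using assms(2) by (auto simp: space_XT_iff)
    then show ?thesis by (auto simp: agent_desc_def)
  qed
  then show ?thesis using assms by (auto simp: formula_event_def joint_agent)
qed

lemma formula_event_sets: "\<phi> \<in> \<L> \<Longrightarrow> evt \<phi> \<in> sets XT"
proof (induction rule: lang.induct)
  case (1 p)
  then have "evt (Prop p) = {z \<in> space XT. Prop p \<in> fst z}"
    by (simp add: fst_vimage lang.intros bool_comb.intros)
  also have "\<dots> = fst -` {x \<in> d\<^sub>0 ` space \<Omega>. Prop p \<in> x} \<inter> space XT"
    by (auto simp: space_XT_iff)
  finally have "evt (Prop p) = fst -` {x \<in> d\<^sub>0 ` space \<Omega>. Prop p \<in> x} \<inter> space XT" .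
  moreover have "fst \<in> measurable XT X" by (simp add: model_product_def)
  moreover have "{x \<in> d\<^sub>0 ` space \<Omega>. Prop p \<in> x} \<in> sets X"
    unfolding model_states_def using 1 by (intro formula_space_event lang.intros)
  ultimately show ?case by (simp only: measurable_sets)
next
  \<comment> \<open>What agent \<open>i\<close> believes is read off coordinate \<open>i\<close>
    alone, so the event is a preimage of a generator of \<open>T i\<close>.\<close>
  case (4 \<phi> i \<theta>)
  then have L: "Bel i \<theta> \<phi> \<in> \<L>" by (auto intro: lang.intros)
  have "Bel i \<theta> \<phi> \<in> bool_comb (bel_atoms i)" using 4 by (auto intro: bool_comb.intros)
  then have "evt (Bel i \<theta> \<phi>) = {z \<in> space XT. Bel i \<theta> \<phi> \<in> snd z i}"
    using 4 L by (simp add: snd_vimage)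
  also have "\<dots> = (\<lambda>z. snd z i) -` {s \<in> d\<^sub>a i ` space \<Omega>. Bel i \<theta> \<phi> \<in> s} \<inter> space XT"
    using XT_component 4 by auto
  finally have "evt (Bel i \<theta> \<phi>) =
      (\<lambda>z. snd z i) -` {s \<in> d\<^sub>a i ` space \<Omega>. Bel i \<theta> \<phi> \<in> s} \<inter> space XT" .
  moreover have "(\<lambda>z. snd z i) \<in> measurable XT (T i)"
    using 4 by (simp add: model_product_def)
  moreover have "{s \<in> d\<^sub>a i ` space \<Omega>. Bel i \<theta> \<phi> \<in> s} \<in> sets (T i)"
    unfolding model_types_def using L by (rule formula_space_event)
  ultimately show ?case by (simp only: measurable_sets)
qed (auto simp: formula_event_Neg formula_event_Conj)

text \<open>The whole space must be added to the generator because \<open>\<L>\<close> is empty if \<open>\<Phi>\<close> is.\<close>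

lemma sets_XT: "sets XT = sigma_sets (space XT) (insert (space XT) (evt ` \<L>))"
  and events_Pow: "insert (space XT) (evt ` \<L>) \<subseteq> Pow (space XT)"
  and events_Int_stable: "Int_stable (insert (space XT) (evt ` \<L>))"
proof -
  let ?G = "insert (space XT) (evt ` \<L>)"
  show Pow: "?G \<subseteq> Pow (space XT)" using formula_event_subset by auto
  show "Int_stable ?G"
  proof (rule Int_stableI)
    fix a b assume "a \<in> ?G" "b \<in> ?G"
    then consider "a = space XT" | "b = space XT"
      | \<phi> \<psi> where "\<phi> \<in> \<L>" "\<psi> \<in> \<L>" "a = evt \<phi>" "b = evt \<psi>" by auto
    then show "a \<inter> b \<in> ?G"
    proof cases
      case 3
      then show ?thesis using formula_event_Conj[of \<phi> \<psi>] lang.intros(3)[of \<phi> \<Phi> I \<Theta> \<psi>] by blast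
    qed (use Pow \<open>a \<in> ?G\<close> \<open>b \<in> ?G\<close> in \<open>auto simp: Int_absorb1 Int_absorb2\<close>)
  qed
  define N where "N = sigma (space XT) ?G"
  have spN: "space N = space XT" and setsN: "sets N = sigma_sets (space XT) ?G"
    using Pow by (simp_all add: N_def space_measure_of sets_measure_of)
  have evN: "evt \<phi> \<in> sets N" if "\<phi> \<in> \<L>" for \<phi> using that by (auto simp: setsN)
  \<comment> \<open>The identity is measurable into the product once its coordinates are, and there
    the preimages of generators are events or empty. This puts every product-measurable set into the
    \<sigma>-algebra of the events.\<close>
  have "(\<lambda>z. (fst z, snd z)) \<in> measurable N XT"
    unfolding model_product_def
  proof (rule measurable_Pair)
    show "fst \<in> measurable N X"
      unfolding model_states_def
      by (rule measurable_formula_space) (auto simp: spN fst_vimage evN space_XT_iff)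
    have "(\<lambda>z i. snd z i) \<in> measurable N (Pi\<^sub>M I T)"
    proof (rule measurable_PiM_single')
      show "(\<lambda>z. snd z i) \<in> measurable N (T i)" if "i \<in> I" for i
        unfolding model_types_def
        using that
        by (intro measurable_formula_space) (auto simp: spN snd_vimage evN dest: XT_component)
      show "(\<lambda>z i. snd z i) \<in> space N \<rightarrow> (\<Pi>\<^sub>E i\<in>I. space (T i))"
        by (rule funcsetI) (simp add: spN space_types space_XT_iff split_paired_all)
    qed
    then show "snd \<in> measurable N (Pi\<^sub>M I T)" by simp
  qed
  then have id: "(\<lambda>z. z) \<in> measurable N XT" by simp
  have "sets XT \<subseteq> sets N"
  proof
    fix A assume A: "A \<in> sets XT"
    then have "A = (\<lambda>z. z) -` A \<inter> space N" using sets.sets_into_space spN by auto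
    then show "A \<in> sets N" using measurable_sets[OF id A] by simp
  qed
  moreover have "sets N \<subseteq> sets XT"
    unfolding setsN using formula_event_sets by (intro sets.sigma_sets_subset) auto
  ultimately show "sets XT = sigma_sets (space XT) ?G" using setsN by auto
qed

section \<open>The description map and its image measures\<close>

lemma desc_measurable: "(\<lambda>\<omega>. (d\<^sub>0 \<omega>, d \<omega>)) \<in> measurable \<Omega> XT"
proof (rule measurable_sigma_sets[OF sets_XT events_Pow])
  fix E assume "E \<in> insert (space XT) (evt ` \<L>)"
  moreover have "(\<lambda>\<omega>. (d\<^sub>0 \<omega>, d \<omega>)) -` space XT \<inter> space \<Omega> = space \<Omega>"
    by (auto simp: desc_in_XT)
  ultimately show "(\<lambda>\<omega>. (d\<^sub>0 \<omega>, d \<omega>)) -` E \<inter> space \<Omega> \<in> sets \<Omega>"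
    by (auto simp: vimage_formula_event truth_in_sets[OF model])
qed (auto simp: desc_in_XT)

lemma agent_desc_measurable: "d\<^sub>a i \<in> measurable \<Omega> (T i)"
  unfolding model_types_def
proof (rule measurable_formula_space)
  fix \<phi> assume "\<phi> \<in> \<L>"
  then have "{\<omega> \<in> space \<Omega>. \<phi> \<in> d\<^sub>a i \<omega>} = (if \<phi> \<in> bool_comb (bel_atoms i) then truth F \<pi> \<phi> else {})"
    using sets.sets_into_space[OF truth_in_sets[OF model]]
    by (auto simp: agent_desc_def world_desc_def)
  then show "{\<omega> \<in> space \<Omega>. \<phi> \<in> d\<^sub>a i \<omega>} \<in> sets \<Omega>"
    using truth_in_sets[OF model \<open>\<phi> \<in> \<L>\<close>] by simp
qed auto

lemma Bel_agent_desc: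
  assumes "i \<in> I" "\<theta> \<in> \<Theta>" "\<phi> \<in> \<L>" "\<omega> \<in> space \<Omega>"
  shows "Bel i \<theta> \<phi> \<in> d\<^sub>a i \<omega> \<longleftrightarrow> \<theta> \<le> measure (Pr F i \<omega>) (truth F \<pi> \<phi>)"
  using assms by (auto simp: agent_desc_def world_desc_def intro: lang.intros bool_comb.intros)

text \<open>Truth of a belief formula of \<open>i\<close> depends on the world only through the
  measure \<open>Pr F i\<close>, and Boolean combinations inherit this.\<close>

lemma agent_desc_cong:
  assumes "\<omega> \<in> space \<Omega>" "\<omega>' \<in> space \<Omega>" and eq: "Pr F i \<omega> = Pr F i \<omega>'"
  shows "d\<^sub>a i \<omega> = d\<^sub>a i \<omega>'"
proof -
  have "\<omega> \<in> truth F \<pi> \<phi> \<longleftrightarrow> \<omega>' \<in> truth F \<pi> \<phi>" if "\<phi> \<in> bool_comb (bel_atoms i)" for \<phi>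
    using that by induction (use assms in auto)
  then show ?thesis by (auto simp: agent_desc_def world_desc_def)
qed

text \<open>The candidate for the belief of the type \<open>d\<^sub>a i \<omega>\<close>. It is
  indexed by a world; that it depends only on the type follows from \<open>beta_eq\<close>.\<close>

definition desc_measure :: "'i \<Rightarrow> 'w \<Rightarrow> (('p, 'i) fm set \<times> ('i \<Rightarrow> ('p, 'i) fm set)) measure" where
  "desc_measure i \<omega> = distr (Pr F i \<omega>) XT (\<lambda>\<omega>. (d\<^sub>0 \<omega>, d \<omega>))"

lemma desc_measurable_Pr:
  "i \<in> I \<Longrightarrow> \<omega> \<in> space \<Omega> \<Longrightarrow> (\<lambda>\<omega>. (d\<^sub>0 \<omega>, d \<omega>)) \<in> measurable (Pr F i \<omega>) XT"
  using desc_measurable by (simp cong: measurable_cong_sets add: sets_Pr)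

lemma desc_measure_prob_algebra:
  "i \<in> I \<Longrightarrow> \<omega> \<in> space \<Omega> \<Longrightarrow> desc_measure i \<omega> \<in> space (prob_algebra XT)"
  by (simp add: desc_measure_def space_prob_algebra
      prob_space.prob_space_distr[OF prob_space_Pr desc_measurable_Pr])

lemma measure_desc_measure:
  assumes "i \<in> I" "\<omega> \<in> space \<Omega>" "\<phi> \<in> \<L>"
  shows "measure (desc_measure i \<omega>) (evt \<phi>) = measure (Pr F i \<omega>) (truth F \<pi> \<phi>)"
  using assms
  by (simp add: desc_measure_def measure_distr desc_measurable_Pr formula_event_sets space_Pr vimage_formula_event)

lemma marginal_desc_measure:
  assumes i: "i \<in> I" and w: "\<omega> \<in> space \<Omega>"
  shows "distr (desc_measure i \<omega>) (T i) (\<lambda>(x, t). t i) = return (T i) (d\<^sub>a i \<omega>)"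
proof -
  interpret p: prob_space "Pr F i \<omega>" using i w by (rule prob_space_Pr)
  have proj: "(\<lambda>(x, t). t i) \<in> measurable XT (T i)"
    using i unfolding model_product_def case_prod_beta by simp
  have da: "d\<^sub>a i \<in> measurable (Pr F i \<omega>) (T i)"
    using agent_desc_measurable i w by (simp cong: measurable_cong_sets add: sets_Pr)
  have "distr (desc_measure i \<omega>) (T i) (\<lambda>(x, t). t i)
      = distr (Pr F i \<omega>) (T i) ((\<lambda>(x, t). t i) \<circ> (\<lambda>\<omega>. (d\<^sub>0 \<omega>, d \<omega>)))"
    unfolding desc_measure_def using proj desc_measurable_Pr[OF i w] by (rule distr_distr)
  also have "(\<lambda>(x, t). t i) \<circ> (\<lambda>\<omega>. (d\<^sub>0 \<omega>, d \<omega>)) = d\<^sub>a i"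
    using i by (auto simp: profile_desc_def)
  also have "distr (Pr F i \<omega>) (T i) (d\<^sub>a i) = return (T i) (d\<^sub>a i \<omega>)"
  proof (rule measure_eqI)
    fix E assume "E \<in> sets (distr (Pr F i \<omega>) (T i) (d\<^sub>a i))"
    then have E: "E \<in> sets (T i)" by simp
    \<comment> \<open>Worlds with the same beliefs as \<open>\<omega>\<close> have the same type and
      lie in the preimage of \<open>A\<close>; the preimage is measurable, so outer measure one
      becomes probability one.\<close>
    have one: "emeasure (Pr F i \<omega>) (d\<^sub>a i -` A \<inter> space \<Omega>) = 1"
      if "A \<in> sets (T i)" "d\<^sub>a i \<omega> \<in> A" for A
    proof (rule emeasure_eq_1_of_outer[OF p.prob_space_axioms])
      show "outer_measure_of (Pr F i \<omega>) {\<omega>' \<in> space \<Omega>. Pr F i \<omega>' = Pr F i \<omega>} = 1"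
        using model i w by (simp add: probability_model_def probability_frame_def)
      show "{\<omega>' \<in> space \<Omega>. Pr F i \<omega>' = Pr F i \<omega>} \<subseteq> d\<^sub>a i -` A \<inter> space \<Omega>"
        using agent_desc_cong[OF _ w] that by auto
      show "d\<^sub>a i -` A \<inter> space \<Omega> \<in> sets (Pr F i \<omega>)"
        using measurable_sets[OF da that(1)] i w by (simp add: space_Pr)
    qed
    have "emeasure (Pr F i \<omega>) (d\<^sub>a i -` E \<inter> space \<Omega>) = indicator E (d\<^sub>a i \<omega>)"
    proof (cases "d\<^sub>a i \<omega> \<in> E")
      \<comment> \<open>\<open>one\<close> speaks of events containing the type; for the others it
        is applied to the complement.\<close>
      case False
      let ?A = "d\<^sub>a i -` E \<inter> space \<Omega>"
      have "d\<^sub>a i -` (space (T i) - E) \<inter> space \<Omega> = space (Pr F i \<omega>) - ?A"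
        using i w by (auto simp: space_Pr space_types)
      then have "emeasure (Pr F i \<omega>) (space (Pr F i \<omega>) - ?A) = 1"
        using one[of "space (T i) - E", OF sets.compl_sets[OF E]] False w by (simp add: space_types)
      moreover have "?A \<in> sets (Pr F i \<omega>)"
        using measurable_sets[OF da E] i w by (simp add: space_Pr)
      ultimately show ?thesis
        using False p.prob_compl[of ?A] by (simp add: p.emeasure_eq_measure)
    qed (use one[OF E] in simp)
    then show "emeasure (distr (Pr F i \<omega>) (T i) (d\<^sub>a i)) E = emeasure (return (T i) (d\<^sub>a i \<omega>)) E"
      using E da i w by (simp add: emeasure_distr space_Pr)
  qed simp
  finally show ?thesis .
qed

lemma model_val_sets: "p \<in> \<Phi> \<Longrightarrow> model_val \<Phi> I \<Theta> F \<pi> p \<in> sets X"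
  by (auto simp: model_val_def model_states_def intro!: formula_space_event lang.intros)

end

section \<open>The belief maps on types\<close>

text \<open>Density fixes a probability by its thresholds, so the measure defining
  \<open>\<beta>\<close> is unique; density and countability together make \<open>\<beta>\<close>
  measurable.\<close>

locale dense_model_language = model_language \<Phi> I \<Theta> F \<pi>
  for \<Phi> :: "'p set" and I :: "'i set" and \<Theta> and F :: "('w, 'i) prob_structure" and \<pi> +
  assumes countable: "countable \<Theta>" and dense: "{0..1} \<subseteq> closure \<Theta>"
begin

lemma prob_measure_eqI:
  assumes \<mu>: "\<mu> \<in> space (prob_algebra XT)" and \<nu>: "\<nu> \<in> space (prob_algebra XT)"
    and iff: "\<And>\<phi> \<theta>. \<phi> \<in> \<L> \<Longrightarrow> \<theta> \<in> \<Theta> \<Longrightarrow> \<theta> \<le> measure \<mu> (evt \<phi>) \<longleftrightarrow> \<theta> \<le> measure \<nu> (evt \<phi>)"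
  shows "\<mu> = \<nu>"
proof -
  from \<mu> interpret m: prob_space \<mu> by (simp add: space_prob_algebra)
  from \<nu> interpret n: prob_space \<nu> by (simp add: space_prob_algebra)
  have sets: "sets \<mu> = sets XT" "sets \<nu> = sets XT"
    using \<mu> \<nu> by (auto simp: space_prob_algebra)
  then have sp: "space \<mu> = space XT" "space \<nu> = space XT" by (auto dest: sets_eq_imp_space_eq)
  show ?thesis
  proof (rule measure_eqI_generator_eq[OF events_Int_stable events_Pow, where A = "\<lambda>_. space XT"])
    fix A assume "A \<in> insert (space XT) (evt ` \<L>)"
    then consider "A = space XT" | \<phi> where "\<phi> \<in> \<L>" "A = evt \<phi>" by auto
    then show "emeasure \<mu> A = emeasure \<nu> A"
    proof cases
      case 1
      then show ?thesis using m.emeasure_space_1 n.emeasure_space_1 sp by simp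
    next
      case 2
      then have "measure \<mu> A = measure \<nu> A"
        using iff by (intro dense_threshold_eqI[OF dense]) auto
      then show ?thesis by (simp add: m.emeasure_eq_measure n.emeasure_eq_measure)
    qed
  qed (use sets sets_XT in auto)
qed

text \<open>The image measure resolves the definite description: on \<open>evt \<phi>\<close> it
  takes the probability of the truth set, which the belief formulas in the type compare with each
  threshold.\<close>

lemma beta_eq:
  assumes i: "i \<in> I" and w: "\<omega> \<in> space \<Omega>"
  shows "\<beta> i (d\<^sub>a i \<omega>) = desc_measure i \<omega>"
  unfolding model_beta_def
proof (rule the_equality)
  show "desc_measure i \<omega> \<in> space (prob_algebra XT) \<and> (\<forall>\<phi>\<in>\<L>. \<forall>\<theta>\<in>\<Theta>.
      \<theta> \<le> measure (desc_measure i \<omega>) (evt \<phi>) \<longleftrightarrow> Bel i \<theta> \<phi> \<in> d\<^sub>a i \<omega>)"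
    using assms by (simp add: desc_measure_prob_algebra measure_desc_measure Bel_agent_desc)
next
  fix \<mu> assume "\<mu> \<in> space (prob_algebra XT) \<and> (\<forall>\<phi>\<in>\<L>. \<forall>\<theta>\<in>\<Theta>.
      \<theta> \<le> measure \<mu> (evt \<phi>) \<longleftrightarrow> Bel i \<theta> \<phi> \<in> d\<^sub>a i \<omega>)"
  then show "\<mu> = desc_measure i \<omega>"
    using assms
    by (intro prob_measure_eqI) (simp_all add: desc_measure_prob_algebra measure_desc_measure Bel_agent_desc)
qed

lemma beta_prob_algebra:
  assumes "i \<in> I" and "s \<in> space (T i)"
  shows "\<beta> i s \<in> space (prob_algebra XT)"
  using assms by (auto simp: space_types beta_eq desc_measure_prob_algebra)

lemma beta_threshold:
  assumes "i \<in> I" and "s \<in> space (T i)" and "\<theta> \<in> \<Theta>" and "\<phi> \<in> \<L>"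
  shows "\<theta> \<le> measure (\<beta> i s) (evt \<phi>) \<longleftrightarrow> Bel i \<theta> \<phi> \<in> s"
  using assms by (auto simp: space_types beta_eq measure_desc_measure Bel_agent_desc)

lemma beta_measurable:
  assumes i: "i \<in> I"
  shows "\<beta> i \<in> measurable (T i) (prob_algebra XT)"
proof (rule measurable_prob_algebra_generated[OF sets_XT events_Int_stable events_Pow])
  have prob: "prob_space (\<beta> i s)" and sets: "sets (\<beta> i s) = sets XT" if "s \<in> space (T i)" for s
    using beta_prob_algebra[OF i that] by (auto simp: space_prob_algebra)
  then show "prob_space (\<beta> i s)" "sets (\<beta> i s) = sets XT" if "s \<in> space (T i)" for s
    using that by auto
  fix A assume "A \<in> insert (space XT) (evt ` \<L>)"
  then consider "A = space XT" | \<phi> where "\<phi> \<in> \<L>" "A = evt \<phi>" by auto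
  then show "(\<lambda>s. emeasure (\<beta> i s) A) \<in> borel_measurable (T i)"
  proof cases
    case 1
    have "emeasure (\<beta> i s) A = 1" if "s \<in> space (T i)" for s
      using prob_space.emeasure_space_1[OF prob[OF that]] sets_eq_imp_space_eq[OF sets[OF that]] 1
      by simp
    then show ?thesis by (simp cong: measurable_cong)
  next
    case 2
    \<comment> \<open>Strict inequalities are used because \<open>a\<close> need not lie in
      \<open>\<Theta>\<close>: exceeding \<open>a\<close> means reaching some threshold in
      \<open>\<Theta>\<close> above \<open>a\<close>, which gives a countable union of generators of
      \<open>T i\<close>.\<close>
    have "(\<lambda>s. measure (\<beta> i s) A) \<in> borel_measurable (T i)"
      unfolding borel_measurable_iff_greater
    proof
      fix a :: real
      show "{s \<in> space (T i). a < measure (\<beta> i s) A} \<in> sets (T i)"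
      \<comment> \<open>Negative \<open>a\<close> is split off because density is available only
        inside the unit interval.\<close>
      proof (cases "a < 0")
        case True
        then have "{s \<in> space (T i). a < measure (\<beta> i s) A} = space (T i)"
          by (auto intro: less_le_trans)
        then show ?thesis by simp
      next
        case False
        have "\<exists>\<theta>\<in>\<Theta>. a < \<theta> \<and> \<theta> \<le> measure (\<beta> i s) A" if "s \<in> space (T i)" "a < measure (\<beta> i s) A" for s
          using dense_between[OF dense that(2)] False prob_space.prob_le_1[OF prob[OF that(1)]]
          by force
        then have "{s \<in> space (T i). a < measure (\<beta> i s) A}
            = (\<Union>\<theta>\<in>{\<theta> \<in> \<Theta>. a < \<theta>}. {s \<in> space (T i). \<theta> \<le> measure (\<beta> i s) A})"
          by force
        also have "\<dots> = (\<Union>\<theta>\<in>{\<theta> \<in> \<Theta>. a < \<theta>}. {s \<in> space (T i). Bel i \<theta> \<phi> \<in> s})"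
          using beta_threshold[OF i] 2 by auto
        also have "\<dots> \<in> sets (T i)"
        proof (rule sets.countable_UN'')
          show "countable {\<theta> \<in> \<Theta>. a < \<theta>}" using countable by simp
          show "{s \<in> space (T i). Bel i \<theta> \<phi> \<in> s} \<in> sets (T i)" if "\<theta> \<in> {\<theta> \<in> \<Theta>. a < \<theta>}" for \<theta>
            using that i 2 unfolding model_types_def space_formula_space
            by (intro formula_space_event lang.intros) auto
        qed
        finally show ?thesis .
      qed
    qed
    then have "(\<lambda>s. ennreal (measure (\<beta> i s) A)) \<in> borel_measurable (T i)" by measurable
    moreover have "emeasure (\<beta> i s) A = ennreal (measure (\<beta> i s) A)" if "s \<in> space (T i)" for s
      using prob[OF that] by (simp add: finite_measure.emeasure_eq_measure prob_space.finite_measure)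
    ultimately show ?thesis by (simp cong: measurable_cong)
  qed
qed

lemma type_space_model_type_space: "type_space I (model_type_space \<Phi> I \<Theta> F \<pi>)"
  unfolding type_space_def product_space_def
  using beta_measurable
  by (auto simp: model_type_space_def model_product_def space_types beta_eq marginal_desc_measure)

section \<open>Truth in the interpreted type space\<close>

lemma type_truth_eq_event:
  assumes "\<phi> \<in> \<L>"
  shows "type_truth I (model_type_space \<Phi> I \<Theta> F \<pi>) (model_val \<Phi> I \<Theta> F \<pi>) \<phi> = evt \<phi>"
  using assms
proof induction
  case (1 p)
  then have "evt (Prop p) = {z \<in> space XT. Prop p \<in> fst z}"
    by (simp add: fst_vimage lang.intros bool_comb.intros)
  also have "\<dots> = {x \<in> space X. Prop p \<in> x} \<times> space (Pi\<^sub>M I T)"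
    unfolding model_product_def space_pair_measure by auto
  finally show ?case
    by (simp add: model_val_def model_type_space_def)
next
  case (4 \<phi> i \<theta>)
  \<comment> \<open>A threshold reached by \<open>\<beta> i (t i)\<close> is recorded in the type
    \<open>t i\<close> by \<open>beta_threshold\<close>, and from there in the joint description by
    \<open>joint_Bel\<close>.\<close>
  have "\<theta> \<le> measure (\<beta> i (t i)) (evt \<phi>) \<longleftrightarrow> Bel i \<theta> \<phi> \<in> joint x t"
    if xt: "(x, t) \<in> space XT" for x t
    using beta_threshold[of i "t i" \<theta> \<phi>] XT_component[OF xt] joint_Bel[OF xt] 4 by (simp add: space_types)
  moreover have "type_truth I (model_type_space \<Phi> I \<Theta> F \<pi>) (model_val \<Phi> I \<Theta> F \<pi>) (Bel i \<theta> \<phi>)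
      = {(x, t) \<in> space XT. \<theta> \<le> measure (\<beta> i (t i)) (evt \<phi>)}"
    using 4 by (simp add: model_type_space_def product_space_def model_product_def)
  ultimately show ?case
    unfolding formula_event_def[of _ _ _ _ _ "Bel i \<theta> \<phi>"] by blast
qed (simp_all add: formula_event_Neg formula_event_Conj model_type_space_def product_space_def model_product_def)

lemma desc_in_type_truth_iff:
  assumes "\<phi> \<in> \<L>" and "\<omega> \<in> space \<Omega>"
  shows "(d\<^sub>0 \<omega>, d \<omega>) \<in> type_truth I (model_type_space \<Phi> I \<Theta> F \<pi>) (model_val \<Phi> I \<Theta> F \<pi>) \<phi>
    \<longleftrightarrow> \<omega> \<in> truth F \<pi> \<phi>"
  using assms vimage_formula_event[OF assms(1)] type_truth_eq_event[OF assms(1)] by auto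

end

theorem proposition7:
  fixes n :: nat and I :: "nat set" and \<Phi> :: "'p set" and \<Theta> :: "real set"
    and F :: "('w, nat) prob_structure" and \<pi> :: "'p \<Rightarrow> 'w set"
  assumes "I = {1..n}"
    and "countable \<Theta>" and "\<Theta> \<subseteq> {0..1}" and "{0..1} \<subseteq> closure \<Theta>"
    and "probability_model \<Phi> I F \<pi>"
  shows "type_space I (model_type_space \<Phi> I \<Theta> F \<pi>) \<and>
    interpreted_type_space \<Phi> I (model_type_space \<Phi> I \<Theta> F \<pi>) (model_val \<Phi> I \<Theta> F \<pi>) \<and>
    (\<forall>\<phi>\<in>lang \<Phi> I \<Theta>. \<forall>\<omega>\<in>space (worlds F).
       \<omega> \<in> truth F \<pi> \<phi> \<longrightarrow>
       (state_desc \<Phi> I \<Theta> F \<pi> \<omega>, profile_desc \<Phi> I \<Theta> F \<pi> \<omega>)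
         \<in> type_truth I (model_type_space \<Phi> I \<Theta> F \<pi>) (model_val \<Phi> I \<Theta> F \<pi>) \<phi>)"
proof -
  interpret dense_model_language \<Phi> I \<Theta> F \<pi>
    by unfold_locales (use assms in auto)
  show ?thesis
    using type_space_model_type_space model_val_sets desc_in_type_truth_iff
    by (auto simp: interpreted_type_space_def model_type_space_def)
qed

end
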